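(* Let $0\le\lambda\le1$. (a) If $\lambda$ is rational, then $\lim_{Q\to\infty}\tilde r_Q(\lambda^+)=\lim_{Q\to\infty}\tilde r_Q(\lambda^-)=0$. (b) If $\lambda$ is irrational, then $\limsup_{Q\to\infty}\tilde r_Q(\lambda)$ lies in the interval $\big[\tfrac{\pi^2}{6}(1+\lambda^2)^{3/2},\ \tfrac{\pi^2}{3}(1+\lambda^2)^{3/2}\big]$. (c) $\liminf_{Q\to\infty}\tilde r_Q(\lambda)>0$ if and only if $\lambda$ is a badly approximable irrational number. In particular, for Lebesgue-almost all $\lambda\in[0,1]$, $\limsup_{Q\to\infty}\tilde r_Q(\lambda)>0$ but $\liminf_{Q\to\infty}\tilde r_Q(\lambda)=0$.
   Context: For a positive integer $Q$, let $V_Q=\{(q,a)\in\mathbb{Z}^2:\gcd(q,a)=1,\ \max\{|q|,|a|\}\le Q\}$ and let $P_Q$ (the Jarník polygon) be the convex polygon, unique up to translation, whose edges (as vectors, traversed counterclockwise) are exactly the vectors of $V_Q$. The edges $(q,a)\in V_Q$ with $q>0$ form a consecutive chain of edges of $P_Q$ ordered by increasing slope $a/q$. For an irrational real $\mu$ with $-1<\mu<2$, let $v_Q(\mu)$ be the vertex of $P_Q$ at which two consecutive edges of this chain meet whose slopes $s_1<s_2$ satisfy $s_1<\mu<s_2$, and let $r_Q(\mu)$ be the radius of the circle through $v_Q(\mu)$ and its two neighboring vertices on $P_Q$ (the radius of curvature of $P_Q$ at that vertex). For rational $\lambda\in[0,1]$, $r_Q(\lambda^+)$ and $r_Q(\lambda^-)$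 denote the values of $r_Q(\mu)$ for irrational $\mu$ sufficiently close to $\lambda$ with $\mu>\lambda$, respectively $\mu<\lambda$ (these are eventually constant). Let $$R(Q)=X(Q,1)+Y(Q,1)-\tfrac12,\quad X(Q,1)=\sum_{q=1}^{Q}q\sum_{\substack{1\le a\le q\\ \gcd(q,a)=1}}1,\quad Y(Q,1)=\sum_{q=1}^{Q}\sum_{\substack{1\le a\le q\\ \gcd(q,a)=1}}a;$$ $R(Q)$ is the distance from the center of $P_Q$ to the edge corresponding to $(1,0)$, i.e. the factor by which $P_Q$ is shrunk to obtain the scaled polygon through $(\pm1,0),(0,\pm1)$. Set $\tilde r_Q(\lambda)=r_Q(\lambda)/R(Q)$ and $\tilde r_Q(\lambda^\pm)=r_Q(\lambda^\pm)/R(Q)$. An irrational $\lambda\in(0,1)$ is badly approximable if the partial quotients $b_n$ in its continued fraction expansion $\lambda=[0;b_1,b_2,\dots]$ are bounded (equivalently, there is $\delta>0$ such that $|\lambda-a/q|<\delta/q^2$ has no solutions in integers $a$, $q\ge1$). *)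

theory Defs
  imports "HOL-Analysis.Analysis"
begin

definition jarnik_vectors :: "nat \<Rightarrow> (int \<times> int) set" where
  "jarnik_vectors Q = {(q, a). gcd q a = 1 \<and> max \<bar>q\<bar> \<bar>a\<bar> \<le> int Q}"

(* [u, v] is an edge of P, and P lies to the left of the directed line from u to v, i.e. the
   edge is traversed from u to v when the boundary of P is traversed counterclockwise. *)
definition ccw_edge :: "(real \<times> real) set \<Rightarrow> real \<times> real \<Rightarrow> real \<times> real \<Rightarrow> bool" where
  "ccw_edge P u v \<longleftrightarrow>
     closed_segment u v edge_of P \<and>
     (\<forall>x\<in>P. fst (v - u) * snd (x - u) - snd (v - u) * fst (x - u) \<ge> 0)"

(* Distinct edges of a convex polygon have distinct counterclockwise directions, so equality
   of sets means that every vector of jarnik_vectors Q occurs exactly once as an edge. *)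
definition jarnik_polygon :: "nat \<Rightarrow> (real \<times> real) set \<Rightarrow> bool" where
  "jarnik_polygon Q P \<longleftrightarrow>
     polytope P \<and> aff_dim P = 2 \<and>
     {v - u | u v. ccw_edge P u v} = (\<lambda>(q, a). (real_of_int q, real_of_int a)) ` jarnik_vectors Q"

definition slope :: "real \<times> real \<Rightarrow> real" where
  "slope e = snd e / fst e"

(* v is the vertex at which two consecutive edges (q,a) of P with q > 0, of slopes
   s1 < mu < s2, meet; u and w are the two neighboring vertices. *)
definition vertex_at_slope ::
  "(real \<times> real) set \<Rightarrow> real \<Rightarrow> real \<times> real \<Rightarrow> real \<times> real \<Rightarrow> real \<times> real \<Rightarrow> bool" where
  "vertex_at_slope P mu u v w \<longleftrightarrow>
     ccw_edge P u v \<and> ccw_edge P v w \<and>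
     fst (v - u) > 0 \<and> fst (w - v) > 0 \<and>
     slope (v - u) < mu \<and> mu < slope (w - v)"

(* The polygon is unique up to translation, so the radius does not depend on the choice of P.
   Meaningful for irrational mu between -1 and 2 (for Q = 1 only when mu < 1). *)
definition curv_radius :: "nat \<Rightarrow> real \<Rightarrow> real" where
  "curv_radius Q mu =
     (THE r. \<exists>P u v w c. jarnik_polygon Q P \<and> vertex_at_slope P mu u v w \<and>
                         {u, v, w} \<subseteq> sphere c r)"

definition curv_radius_right :: "nat \<Rightarrow> real \<Rightarrow> real" where
  "curv_radius_right Q lam =
     (THE r. \<forall>\<^sub>F mu in at_right lam. mu \<notin> \<rat> \<longrightarrow> curv_radius Q mu = r)"

definition curv_radius_left :: "nat \<Rightarrow> real \<Rightarrow> real" where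
  "curv_radius_left Q lam =
     (THE r. \<forall>\<^sub>F mu in at_left lam. mu \<notin> \<rat> \<longrightarrow> curv_radius Q mu = r)"

definition X_sum :: "nat \<Rightarrow> real" where
  "X_sum Q = (\<Sum>q=1..Q. real q * (\<Sum>a | 1 \<le> a \<and> a \<le> q \<and> gcd q a = 1. 1))"

definition Y_sum :: "nat \<Rightarrow> real" where
  "Y_sum Q = (\<Sum>q=1..Q. \<Sum>a | 1 \<le> a \<and> a \<le> q \<and> gcd q a = 1. real a)"

definition scale_factor :: "nat \<Rightarrow> real" where
  "scale_factor Q = X_sum Q + Y_sum Q - 1/2"

definition scaled_radius :: "nat \<Rightarrow> real \<Rightarrow> real" where
  "scaled_radius Q lam = curv_radius Q lam / scale_factor Q"

definition scaled_radius_right :: "nat \<Rightarrow> real \<Rightarrow> real" where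
  "scaled_radius_right Q lam = curv_radius_right Q lam / scale_factor Q"

definition scaled_radius_left :: "nat \<Rightarrow> real \<Rightarrow> real" where
  "scaled_radius_left Q lam = curv_radius_left Q lam / scale_factor Q"

(* Complete remainders of the continued fraction [0; b_1, b_2, ...] of an irrational number
   in (0,1); b_(n+1) is partial_quotient x n. *)
primrec cf_remainder :: "real \<Rightarrow> nat \<Rightarrow> real" where
  "cf_remainder x 0 = x"
| "cf_remainder x (Suc n) = frac (1 / cf_remainder x n)"

definition partial_quotient :: "real \<Rightarrow> nat \<Rightarrow> int" where
  "partial_quotient x n = \<lfloor>1 / cf_remainder x n\<rfloor>"

definition badly_approximable :: "real \<Rightarrow> bool" where
  "badly_approximable x \<longleftrightarrow>
     0 < x \<and> x < 1 \<and> x \<notin> \<rat> \<and> (\<exists>B. \<forall>n. partial_quotient x n \<le> B)"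

end

theory Submission
  imports Defs
begin

text \<open>
  At a vertex with incident edges \<open>e\<^sub>1, e\<^sub>2\<close> the radius of curvature is
  \<open>|e\<^sub>1| |e\<^sub>2| |e\<^sub>1 + e\<^sub>2| / (2 det(e\<^sub>1, e\<^sub>2))\<close>. For irrational \<open>\<lambda>\<close> the edges \<open>(q, a)\<close>,
  \<open>(r, b)\<close> are the neighbours of \<open>\<lambda>\<close> in the Farey sequence of order \<open>Q\<close>, so the determinant is 1 and
  the radius is asymptotic to \<open>q r (q + r) (1 + \<lambda>\<^sup>2)\<^bsup>3/2\<^esup> / 2\<close>, while \<open>R(Q) \<sim> 3 Q\<^sup>3 / \<pi>\<^sup>2\<close>. Everything
  is thus governed by \<open>\<rho> = q r (q + r) / Q\<^sup>3\<close>. Always \<open>\<rho> \<le> 2\<close>; when a mediant replaces the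
  neighbour with the smaller denominator, \<open>\<rho> \<ge> 1\<close> at the order where one of the two pairs arises;
  and \<open>\<rho>\<close> stays away from 0 iff \<open>min q r / Q\<close> does, i.e. iff \<open>\<lambda>\<close> is badly approximable. If \<open>\<lambda>\<close> is
  rational, one of the two edges is eventually constant and the radius is only \<open>O(Q\<^sup>2)\<close>.
\<close>

subsection \<open>The scale factor\<close>

text \<open>The size of R(Q) comes from a self-referential identity: sorting all pairs 1 <= a <= q
  <= n by their gcd ties S(n), the sum of q + a over coprime pairs, to the values S(n div d). The
  ansatz c n^3 fits iff c zeta(2) = 1/2, whence 3 / pi^2, and the relative error then obeys a
  contracting recursion. The radius is given by a definite description over all polygons with the
  prescribed edges. One such polygon is built as a Minkowski sum of segments; in an arbitrary one
  the two edges at the vertex are identified locally, by convexity. Continued fractions enter only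
  in translating bounded partial quotients into a lower bound for min q r / Q and back. That almost
  no number is badly approximable comes from the Gauss measure: the numbers with quotients at most B
  are covered by the images of that same set under only B inverse branches of the Gauss map.\<close>

definition coprime_sum :: "nat \<Rightarrow> real" where
  "coprime_sum n = (\<Sum>(q, a) | a \<ge> 1 \<and> a \<le> q \<and> q \<le> n \<and> coprime q a. real q + real a)"

lemma finite_coprime_pairs: "finite {(q, a). a \<ge> 1 \<and> a \<le> q \<and> q \<le> (n::nat) \<and> coprime q a}"
  by (rule finite_subset[of _ "{..n} \<times> {..n}"]) auto

lemma coprime_sum_0: "coprime_sum 0 = 0"
  unfolding coprime_sum_def by (rule sum.neutral) auto

lemma scale_factor_eq_coprime_sum: "scale_factor n = coprime_sum n - 1/2"
proof -
  have "coprime_sum n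
      = (\<Sum>(q, a)\<in>(SIGMA q:{1..n}. {a. 1 \<le> a \<and> a \<le> q \<and> gcd q a = 1}). real q + real a)"
    unfolding coprime_sum_def by (intro sum.cong) (auto simp: coprime_iff_gcd_eq_1)
  also have "\<dots> = (\<Sum>q=1..n. \<Sum>a | 1 \<le> a \<and> a \<le> q \<and> gcd q a = 1. real q + real a)"
    by (subst sum.Sigma) auto
  also have "\<dots> = X_sum n + Y_sum n"
    unfolding X_sum_def Y_sum_def by (simp add: sum.distrib mult.commute)
  finally show ?thesis
    by (simp add: scale_factor_def)
qed

lemma sum_all_pairs: "(\<Sum>q=1..n. \<Sum>a=1..q. real q + real a) = real n * (real n + 1)^2 / 2"
proof (induction n)
  case (Suc n)
  have "(\<Sum>a=1..m. real q + real a) = real m * real q + real m * (real m + 1) / 2" for m q :: nat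
    by (induction m) (auto simp: field_simps)
  from this[of "Suc n" "Suc n"] Suc show ?case
    by (simp add: field_simps power2_eq_square)
qed auto

text \<open>Every pair of positive integers is a coprime pair scaled by its gcd.\<close>
lemma sum_coprime_sum_div:
  "(\<Sum>d=1..n. real d * coprime_sum (n div d)) = real n * (real n + 1)^2 / 2"
proof -
  let ?T = "\<lambda>m. {(q, a). a \<ge> 1 \<and> a \<le> q \<and> q \<le> (m::nat) \<and> coprime q a}"
  have "(\<Sum>q=1..n. \<Sum>a=1..q. real q + real a)
      = (\<Sum>(q, a)\<in>(SIGMA q:{1..n}. {1..q}). real q + real a)"
    by (subst sum.Sigma) auto
  also have "\<dots> = (\<Sum>(d, q, a)\<in>(SIGMA d:{1..n}. ?T (n div d)). real d * (real q + real a))"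
  proof (rule sum.reindex_bij_witness[of _ "\<lambda>(d, q, a). (d * q, d * a)"
        "\<lambda>(q, a). (gcd q a, q div gcd q a, a div gcd q a)"], goal_cases)
    case (2 x)
    then obtain q a where x: "x = (q, a)" "1 \<le> q" "q \<le> n" "1 \<le> a" "a \<le> q" by auto
    then have "gcd q a \<ge> 1" by (metis One_nat_def Suc_leI bot_nat_0.not_eq_extremum gcd_eq_0_iff not_one_le_zero)
    moreover have "gcd q a \<le> n" using x by (meson dvd_imp_le gcd_dvd1 le_trans less_le_trans zero_less_one)
    moreover have "coprime (q div gcd q a) (a div gcd q a)"
      using x by (intro div_gcd_coprime) auto
    moreover have "1 \<le> a div gcd q a"
      using x by (metis One_nat_def Suc_leI div_greater_zero_iff dvd_imp_le gcd_dvd2 gcd_pos_nat less_eq_Suc_le not_one_le_zero)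
    ultimately show ?case using x by (auto simp: div_le_mono)
  next
    case (3 x)
    then show ?case
      by (auto simp: gcd_mult_left)
  next
    case (4 x)
    then obtain d q a where x: "x = (d, q, a)" "1 \<le> d" "d \<le> n" "a \<ge> 1" "a \<le> q" "q \<le> n div d" "coprime q a"
      by auto
    then have "q * d \<le> n" by (meson less_eq_div_iff_mult_less_eq less_le_trans zero_less_one)
    moreover have "1 \<le> d * q" "1 \<le> d * a" using x by auto
    ultimately show ?case using x by (auto simp: mult.commute)
  next
    case (5 x)
    then show ?case
      by (auto simp: real_of_nat_div field_simps)
  qed (auto simp: gcd_mult_left)
  also have "\<dots> = (\<Sum>d=1..n. \<Sum>(q, a)\<in>?T (n div d). real d * (real q + real a))"
    by (subst sum.Sigma) (use finite_coprime_pairs in auto)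
  also have "\<dots> = (\<Sum>d=1..n. real d * coprime_sum (n div d))"
    unfolding coprime_sum_def by (simp add: sum_distrib_left case_prod_unfold)
  finally show ?thesis
    by (simp only: sum_all_pairs)
qed


lemma sum_inverse_squares_from: 
  assumes "m \<ge> 1" shows "(\<Sum>d=Suc m..n. 1 / (real d)^2) \<le> 1 / real m"
proof -
  \<comment> \<open>Telescoping 1 / d^2 <= 1 / (d - 1) - 1 / d. The end term 1 / n is kept for the
    induction; the \<open>if\<close> covers the empty sum.\<close>
  have "(\<Sum>d=Suc m..n. 1 / (real d)^2) \<le> 1 / real m - (if m \<le> n then 1 / real n else 0)"
  proof (induction n)
    case (Suc n)
    show ?case
    proof (cases "m \<le> n")
      case True
      have "1 / (real (Suc n))^2 \<le> 1 / real n - 1 / real (Suc n)"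
        using True assms by (simp add: divide_simps power2_eq_square)
      then show ?thesis using Suc True by simp
    qed (use Suc assms in \<open>auto simp: le_Suc_eq\<close>)
  qed (use assms in auto)
  also have "\<dots> \<le> 1 / real m" by auto
  finally show ?thesis .
qed

text \<open>The term d = 2 is split off first, because telescoping from it would only give the bound
  1, too weak for a contraction.\<close>

lemma sum_inverse_squares_from_2: "(\<Sum>d=2..n. 1 / (real d)^2) \<le> 3/4"
proof (cases "n \<ge> 2")
  case True
  then have "(\<Sum>d=2..n. 1 / (real d)^2) = 1/4 + (\<Sum>d=Suc 2..n. 1 / (real d)^2)"
    by (subst sum.atLeast_Suc_atMost) auto
  also have "\<dots> \<le> 1/4 + 1/2"
    using sum_inverse_squares_from[of 2 n] by simp
  finally show ?thesis by simp
qed auto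

text \<open>The iteration contracts because \<open>\<Sum>d\<ge>2. 1/d\<^sup>2 \<le> 3/4 < 1\<close>.\<close>
lemma contraction_tendsto_0:
  fixes h E :: "nat \<Rightarrow> real"
  assumes nonneg: "\<And>n. 0 \<le> h n" and bound: "\<And>n. h n \<le> K"
    and rec: "\<And>n. n \<ge> 1 \<Longrightarrow> h n \<le> (\<Sum>d=2..n. 1 / (real d)^2 * h (n div d)) + E n"
    and E: "E \<longlonglongrightarrow> 0"
  shows "h \<longlonglongrightarrow> 0"
proof -
  have K0: "0 \<le> K" using nonneg[of 0] bound[of 0] by linarith
  \<comment> \<open>An eventual bound B improves to 7/8 B: the factor 3/4 comes from the sum of 1 /
    d^2, and the remaining B / 8 absorbs the far terms together with \<open>E\<close>.\<close>
  have step: "\<exists>N. \<forall>n\<ge>N. h n \<le> 7/8 * B" if N: "\<And>n. n \<ge> N \<Longrightarrow> h n \<le> B" and "B > 0" for N B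
  proof -
    define M where "M = max N 1"
    have lim: "(\<lambda>n. K * (1 / real (n div M)) + E n) \<longlonglongrightarrow> K * 0 + 0"
    proof (intro tendsto_intros E)
      have "filterlim (\<lambda>n. n div M) at_top at_top"
      proof (subst filterlim_at_top, intro allI)
        fix Z
        show "eventually (\<lambda>n. Z \<le> n div M) at_top"
          using eventually_ge_at_top[of "Z * M"]
          by eventually_elim (auto simp: M_def less_eq_div_iff_mult_less_eq)
      qed
      then show "(\<lambda>n. 1 / real (n div M)) \<longlonglongrightarrow> 0"
        using filterlim_compose[OF lim_1_over_n] by blast
    qed
    have "eventually (\<lambda>n. K * (1 / real (n div M)) + E n < B / 8) sequentially"
      using order_tendstoD(2)[OF lim, of "B/8"] \<open>B > 0\<close> by simp
    moreover have "eventually (\<lambda>n. n \<ge> M) sequentially"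
      by (rule eventually_ge_at_top)
    ultimately have "eventually (\<lambda>n. h n \<le> 7/8 * B) sequentially"
    proof eventually_elim
      case (elim n)
      let ?k = "n div M"
      have k1: "?k \<ge> 1" using elim(2) by (simp add: M_def Suc_leI div_greater_zero_iff)
      have M1: "M \<ge> 1" by (simp add: M_def)
      have kn: "?k \<le> n" by (rule div_le_dividend)
      \<comment> \<open>For d <= n div M the argument n div d is at least M, so the bound B applies;
        all other d form a tail of total weight at most 1 / (n div M), where the crude bound K
        suffices.\<close>
      have eq: "{2..n} = {2..?k} \<union> {Suc ?k..n}" using k1 kn order_trans[OF _ kn] by auto
      have "(\<Sum>d=2..n. 1 / (real d)^2 * h (n div d))
          = (\<Sum>d=2..?k. 1 / (real d)^2 * h (n div d)) + (\<Sum>d=Suc ?k..n. 1 / (real d)^2 * h (n div d))"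
        unfolding eq by (rule sum.union_disjoint) auto
      also have "\<dots> \<le> (\<Sum>d=2..?k. 1 / (real d)^2 * B) + (\<Sum>d=Suc ?k..n. 1 / (real d)^2 * K)"
      proof (intro add_mono sum_mono mult_left_mono)
        fix d assume d: "d \<in> {2..?k}"
        then have "d * M \<le> n" using M1
          by (metis atLeastAtMost_iff less_eq_div_iff_mult_less_eq less_le_trans zero_less_one)
        then have "M \<le> n div d" using d
          by (simp add: less_eq_div_iff_mult_less_eq mult.commute)
        then show "h (n div d) \<le> B" by (intro N) (simp add: M_def)
      qed (auto simp: bound)
      also have "\<dots> = B * (\<Sum>d=2..?k. 1 / (real d)^2) + K * (\<Sum>d=Suc ?k..n. 1 / (real d)^2)"
        by (simp add: sum_distrib_left mult.commute)
      also have "\<dots> \<le> B * (3/4) + K * (1 / real ?k)"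
        by (intro add_mono mult_left_mono sum_inverse_squares_from_2 sum_inverse_squares_from k1)
           (use K0 \<open>B > 0\<close> in auto)
      finally have "h n \<le> B * (3/4) + K * (1 / real ?k) + E n"
        using rec[of n] elim(2) M1 by linarith
      with elim(1) show ?case by linarith
    qed
    then show ?thesis by (simp add: eventually_sequentially)
  qed
  have iter: "\<exists>N. \<forall>n\<ge>N. h n \<le> (7/8)^k * (K + 1)" for k
  proof (induction k)
    case 0
    have "h n \<le> K + 1" for n using bound[of n] by linarith
    then show ?case by auto
  next
    case (Suc k)
    then show ?case using step[of _ "(7/8)^k * (K + 1)"] K0 by (auto simp: mult.assoc)
  qed
  show ?thesis
  proof (rule LIMSEQ_I)
    fix r :: real assume "r > 0"
    have "(\<lambda>k. (7/8)^k * (K + 1)) \<longlonglongrightarrow> 0 * (K + 1)"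
      by (intro tendsto_intros LIMSEQ_realpow_zero) auto
    then have "eventually (\<lambda>k. (7/8)^k * (K + 1) < r) sequentially"
      using \<open>r > 0\<close> by (intro order_tendstoD) auto
    then obtain k where k: "(7/8)^k * (K + 1) < r"
      by (auto simp: eventually_sequentially)
    from iter[of k] obtain N where "\<And>n. n \<ge> N \<Longrightarrow> h n \<le> (7/8)^k * (K + 1)" by blast
    then have "\<forall>n\<ge>N. norm (h n - 0) < r"
      using k nonneg by fastforce
    then show "\<exists>N. \<forall>n\<ge>N. norm (h n - 0) < r" by blast
  qed
qed

section \<open>Leading constant of the coprime sum\<close>

lemma div_ratio_tendsto:
  assumes "d \<ge> 1" shows "(\<lambda>n. real (n div d) / real n) \<longlonglongrightarrow> 1 / real d"
proof (rule tendsto_sandwich)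
  show "eventually (\<lambda>n. 1 / real d - 1 / real n \<le> real (n div d) / real n) sequentially"
    using eventually_gt_at_top[of 0]
  proof eventually_elim
    case (elim n)
    have "real n / real d - 1 \<le> real (n div d)"
      using floor_divide_of_nat_eq[of n d, where ?'a = real] by linarith
    then have "(real n / real d - 1) / real n \<le> real (n div d) / real n"
      by (rule divide_right_mono) simp
    then show ?case using elim by (simp add: diff_divide_distrib)
  qed
  show "eventually (\<lambda>n. real (n div d) / real n \<le> 1 / real d) sequentially"
    using eventually_gt_at_top[of 0]
  proof eventually_elim
    case (elim n)
    have "real (n div d) \<le> real n / real d" by (rule of_nat_div_le_of_nat)
    then show ?case using elim by (simp add: field_simps)
  qed
  show "(\<lambda>n. 1 / real d - 1 / real n) \<longlonglongrightarrow> 1 / real d"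
    using tendsto_diff[OF tendsto_const lim_1_over_n, of "1 / real d"] by simp
qed auto

text \<open>After division by n^3 the term of index d tends to 1 / d^2 and is dominated by it, so
  Tannery's theorem yields zeta(2). Terms with d > n vanish because n div d = 0, which makes the
  finite sum a full series.\<close>

lemma sum_div_cubes_tendsto:
  "(\<lambda>n. (\<Sum>d=1..n. real d * (real (n div d))^3) / real n ^ 3) \<longlonglongrightarrow> pi^2 / 6"
proof -
  define a where "a = (\<lambda>k n. real (Suc k) * (real (n div Suc k) / real n)^3)"
  have b: "norm (a k n) \<le> 1 / real (Suc k)^2" for k n
  proof (cases "n = 0")
    case False
    have "real (n div Suc k) \<le> real n / real (Suc k)" by (rule of_nat_div_le_of_nat)
    then have "real (n div Suc k) / real n \<le> 1 / real (Suc k)" using False by (simp add: field_simps)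
    then have "(real (n div Suc k) / real n)^3 \<le> (1 / real (Suc k))^3" by (intro power_mono) auto
    then have "a k n \<le> real (Suc k) * (1 / real (Suc k))^3" unfolding a_def by (intro mult_left_mono) auto
    also have "\<dots> = 1 / real (Suc k)^2" by (simp add: power2_eq_square power3_eq_cube del: of_nat_Suc)
    finally show ?thesis by (simp add: a_def)
  qed (simp add: a_def)
  have sums: "(\<lambda>k. 1 / real (Suc k)^2) sums (pi^2/6)"
    using inverse_squares_sums by simp
  have lim: "(\<lambda>n. a k n) \<longlonglongrightarrow> 1 / real (Suc k)^2" for k
  proof -
    have "(\<lambda>n. a k n) \<longlonglongrightarrow> real (Suc k) * (1 / real (Suc k))^3"
      unfolding a_def by (intro tendsto_intros div_ratio_tendsto) auto
    then show ?thesis by (simp add: power2_eq_square power3_eq_cube del: of_nat_Suc)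
  qed
  have "(\<lambda>n. suminf (\<lambda>k. a k n)) \<longlonglongrightarrow> (\<Sum>k. 1 / real (Suc k)^2)"
    using tannerys_theorem[of a "\<lambda>k. 1 / real (Suc k)^2" sequentially "\<lambda>k. 1 / real (Suc k)^2"] lim b
      sums_summable[OF sums] by (simp add: case_prod_unfold)
  moreover have "suminf (\<lambda>k. a k n) = (\<Sum>d=1..n. real d * (real (n div d))^3) / real n ^ 3" for n
  proof -
    have "suminf (\<lambda>k. a k n) = (\<Sum>k<n. a k n)"
      by (rule suminf_finite) (auto simp: a_def)
    also have "\<dots> = (\<Sum>d=1..n. real d * (real (n div d) / real n)^3)"
      unfolding a_def by (rule sum.reindex_bij_witness[of _ "\<lambda>d. d - 1" Suc]) auto
    also have "\<dots> = (\<Sum>d=1..n. real d * (real (n div d))^3) / real n ^ 3"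
      by (simp add: sum_divide_distrib power_divide)
    finally show ?thesis .
  qed
  ultimately show ?thesis using sums_unique[OF sums] by simp
qed

lemma coprime_sum_nonneg: "0 \<le> coprime_sum n"
  unfolding coprime_sum_def by (rule sum_nonneg) auto

text \<open>The left side is the d = 1 term of a nonnegative sum with known value. This supplies the
  a priori bound that the contraction needs.\<close>

lemma coprime_sum_le: "coprime_sum n \<le> 2 * real n ^ 3"
proof (cases "n = 0")
  case False
  have "coprime_sum n = real 1 * coprime_sum (n div 1)" by simp
  also have "\<dots> \<le> (\<Sum>d=1..n. real d * coprime_sum (n div d))"
    using False by (intro member_le_sum) (auto simp: coprime_sum_nonneg)
  also have "\<dots> = real n * (real n + 1)^2 / 2" by (rule sum_coprime_sum_div)
  also have "\<dots> \<le> real n * (real n + real n)^2 / 2"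
    using False by (intro divide_right_mono mult_left_mono power_mono) auto
  also have "\<dots> = 2 * real n ^ 3" by (simp add: power2_eq_square power3_eq_cube)
  finally show ?thesis .
qed (auto simp: coprime_sum_0)

text \<open>With c (pi^2 / 6) = 1/2 the cubic terms cancel in the gcd identity. So the error
  \<open>g\<close> has weighted sums \<open>D\<close> of order o(n^3), and
  \<open>contraction_tendsto_0\<close> applies to its relative size \<open>h\<close>.\<close>

lemma coprime_sum_asymptotic: "(\<lambda>n. coprime_sum n / real n ^ 3) \<longlonglongrightarrow> 3 / pi^2"
proof -
  define c where "c = 3 / pi^2"
  have c0: "0 \<le> c" by (simp add: c_def)
  define g where "g = (\<lambda>n. coprime_sum n - c * real n ^ 3)"
  define h where "h = (\<lambda>n. \<bar>g n\<bar> / real n ^ 3)"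
  define D where "D = (\<lambda>n. \<Sum>d=1..n. real d * g (n div d))"
  define E where "E = (\<lambda>n. \<bar>D n / real n ^ 3\<bar>)"
  have gh: "\<bar>g n\<bar> = h n * real n ^ 3" for n
    by (cases "n = 0") (auto simp: h_def g_def coprime_sum_0)
  have "h \<longlonglongrightarrow> 0"
  proof (rule contraction_tendsto_0)
    show "0 \<le> h n" for n by (simp add: h_def)
    show "h n \<le> 2 + c" for n
    proof (cases "n = 0")
      case False
      have "\<bar>g n\<bar> \<le> coprime_sum n + c * real n ^ 3"
        unfolding g_def using coprime_sum_nonneg[of n] c0
        by (smt (verit) of_nat_0_le_iff zero_le_mult_iff zero_le_power)
      also have "\<dots> \<le> (2 + c) * real n ^ 3" using coprime_sum_le[of n] by (simp add: algebra_simps)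
      finally show ?thesis using False by (simp add: h_def field_simps)
    qed (use c0 in \<open>auto simp: h_def\<close>)
    have "D n = real n * (real n + 1)^2 / 2 - c * (\<Sum>d=1..n. real d * (real (n div d))^3)" for n
      unfolding D_def g_def using sum_coprime_sum_div[of n]
      by (simp add: right_diff_distrib sum_subtractf sum_distrib_left mult_ac)
    then have D_eq: "(\<lambda>n. D n / real n ^ 3) = (\<lambda>n. real n * (real n + 1)^2 / 2 / real n ^ 3
        - c * ((\<Sum>d=1..n. real d * (real (n div d))^3) / real n ^ 3))"
      by (auto simp: diff_divide_distrib)
    have "(\<lambda>n. real n * (real n + 1)^2 / 2 / real n ^ 3) \<longlonglongrightarrow> 1/2"
    proof -
      have "(\<lambda>n. (1 + 1 / real n)^2 / 2) \<longlonglongrightarrow> (1 + 0)^2/2"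
        by (intro tendsto_intros lim_1_over_n) auto
      moreover have "eventually (\<lambda>n. (1 + 1 / real n)^2 / 2 = real n * (real n + 1)^2 / 2 / real n ^ 3) sequentially"
        using eventually_gt_at_top[of 0]
        by eventually_elim (simp add: field_simps power2_eq_square power3_eq_cube)
      ultimately show ?thesis using Lim_transform_eventually by fastforce
    qed
    then have "(\<lambda>n. D n / real n ^ 3) \<longlonglongrightarrow> 1/2 - c * (pi^2/6)"
      unfolding D_eq by (intro tendsto_diff tendsto_mult_left sum_div_cubes_tendsto)
    then have "(\<lambda>n. D n / real n ^ 3) \<longlonglongrightarrow> 0"
      by (simp add: c_def)
    then show "E \<longlonglongrightarrow> 0" unfolding E_def by (rule tendsto_rabs_zero)
    show "h n \<le> (\<Sum>d=2..n. 1 / (real d)^2 * h (n div d)) + E n" if n: "n \<ge> 1" for n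
    proof -
      \<comment> \<open>Solving for the d = 1 term turns the identity into the recursion for the
        error.\<close>
      have "D n = g n + (\<Sum>d=2..n. real d * g (n div d))"
        unfolding D_def using n by (subst sum.atLeast_Suc_atMost) (auto simp: numeral_2_eq_2)
      then have "\<bar>g n\<bar> \<le> \<bar>\<Sum>d=2..n. real d * g (n div d)\<bar> + \<bar>D n\<bar>" by linarith
      also have "\<bar>\<Sum>d=2..n. real d * g (n div d)\<bar> \<le> (\<Sum>d=2..n. \<bar>real d * g (n div d)\<bar>)"
        by (rule sum_abs)
      also have "\<dots> = (\<Sum>d=2..n. real d * real (n div d)^3 * h (n div d))"
        by (simp add: abs_mult gh mult_ac)
      also have "\<dots> \<le> (\<Sum>d=2..n. real n ^ 3 * (1 / real d^2) * h (n div d))"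
      proof (intro sum_mono mult_right_mono)
        fix d assume d: "d \<in> {2..n}"
        have "real (n div d)^3 \<le> (real n / real d)^3"
          by (intro power_mono of_nat_div_le_of_nat) auto
        then have "real d * real (n div d)^3 \<le> real d * (real n / real d)^3"
          by (intro mult_left_mono) auto
        also have "\<dots> = real n ^ 3 * (1 / real d^2)"
          using d by (simp add: field_simps power2_eq_square power3_eq_cube)
        finally show "real d * real (n div d)^3 \<le> real n ^ 3 * (1 / real d^2)" .
      qed (simp add: h_def)
      also have "\<dots> = real n ^ 3 * (\<Sum>d=2..n. 1 / (real d)^2 * h (n div d))"
        by (simp add: sum_distrib_left mult_ac)
      finally have "\<bar>g n\<bar> / real n ^ 3
          \<le> (real n ^ 3 * (\<Sum>d=2..n. 1 / (real d)^2 * h (n div d)) + \<bar>D n\<bar>) / real n ^ 3"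
        by (intro divide_right_mono) auto
      then show ?thesis using n by (simp add: h_def E_def add_divide_distrib abs_divide)
    qed
  qed
  then have "(\<lambda>n. \<bar>g n / real n ^ 3\<bar>) \<longlonglongrightarrow> 0"
    by (simp add: h_def abs_divide)
  then have "(\<lambda>n. g n / real n ^ 3) \<longlonglongrightarrow> 0"
    by (rule tendsto_rabs_zero_cancel)
  then have "(\<lambda>n. g n / real n ^ 3 + c) \<longlonglongrightarrow> 0 + c" by (intro tendsto_intros)
  moreover have "eventually (\<lambda>n. g n / real n ^ 3 + c = coprime_sum n / real n ^ 3) sequentially"
    using eventually_gt_at_top[of 0] by eventually_elim (simp add: g_def field_simps)
  ultimately show ?thesis unfolding c_def by (simp add: tendsto_cong)
qed

lemma scale_factor_asymptotic: "(\<lambda>n. scale_factor n / real n ^ 3) \<longlonglongrightarrow> 3 / pi^2"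
proof -
  have "(\<lambda>n. coprime_sum n / real n ^ 3 - 1/2 * (1 / real n)^3) \<longlonglongrightarrow> 3 / pi^2 - 1/2 * 0 ^ 3"
    by (intro tendsto_intros coprime_sum_asymptotic lim_1_over_n)
  then show ?thesis
    by (simp add: scale_factor_eq_coprime_sum diff_divide_distrib power_divide)
qed

subsection \<open>Polygons with prescribed edges\<close>

definition cross :: "real \<times> real \<Rightarrow> real \<times> real \<Rightarrow> real" where
  "cross u v = fst u * snd v - snd u * fst v"

lemma cross_self [simp]: "cross u u = 0"
  and cross_0 [simp]: "cross u 0 = 0" "cross 0 u = 0"
  and cross_minus [simp]: "cross u (- v) = - cross u v" "cross (- u) v = - cross u v"
  and cross_scaleR [simp]: "cross u (c *\<^sub>R v) = c * cross u v" "cross (c *\<^sub>R u) v = c * cross u v"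
  by (simp_all add: cross_def algebra_simps)

lemma cross_add: "cross u (v + w) = cross u v + cross u w" "cross (v + w) u = cross v u + cross w u"
  and cross_diff: "cross u (v - w) = cross u v - cross u w" "cross (v - w) u = cross v u - cross w u"
  by (simp_all add: cross_def algebra_simps)

lemma cross_sum: "cross u (\<Sum>i\<in>A. f i) = (\<Sum>i\<in>A. cross u (f i))"
  by (induction A rule: infinite_finite_induct) (auto simp: cross_add)

lemma cross_commute: "cross v u = - cross u v"
  by (simp add: cross_def)

lemma cross_eq_inner: "cross u v = (- snd u, fst u) \<bullet> v"
  by (simp add: cross_def inner_prod_def)

text \<open>Cramer's rule in the plane. When all three coefficients are positive it places w inside
  the cone spanned by u and v.\<close>

lemma cross_decomp: "cross u v *\<^sub>R w = cross w v *\<^sub>R u + cross u w *\<^sub>R v"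
  by (simp add: cross_def prod_eq_iff algebra_simps)

lemma cross_eq_0_cancel:
  assumes "cross u x = 0" "cross v x = 0" "cross u v \<noteq> 0" shows "x = 0"
  using cross_decomp[of u v x] assms by (simp add: cross_commute[of x v])

lemma ccw_edge_iff:
  "ccw_edge P u v \<longleftrightarrow> closed_segment u v edge_of P \<and> (\<forall>x\<in>P. 0 \<le> cross (v - u) (x - u))"
  by (simp add: ccw_edge_def cross_def)

text \<open>The Minkowski sum of the segments from 0 to f / 2. For symmetric V the vectors f and - f
  jointly contribute the segment from - f / 2 to f / 2, so the boundary contains f itself as an
  edge, and - f on the opposite side.\<close>

definition half_zonotope :: "'a set \<Rightarrow> 'a::real_vector set" where
  "half_zonotope V = {(\<Sum>f\<in>V. t f *\<^sub>R f) | t. \<forall>f\<in>V. 0 \<le> t f \<and> t f \<le> 1/2}"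

lemma half_zonotope_insert:
  assumes "finite V" "f \<notin> V"
  shows "half_zonotope (insert f V)
    = closed_segment 0 ((1/2) *\<^sub>R f) + half_zonotope V" (is "?L = ?R")
proof
  show "?L \<subseteq> ?R"
  proof
    fix z assume "z \<in> ?L"
    then obtain t where t: "z = (\<Sum>g\<in>insert f V. t g *\<^sub>R g)" "\<forall>g\<in>insert f V. 0 \<le> t g \<and> t g \<le> 1/2"
      by (auto simp: half_zonotope_def)
    then have "z = t f *\<^sub>R f + (\<Sum>g\<in>V. t g *\<^sub>R g)" using assms by simp
    moreover have "t f *\<^sub>R f \<in> closed_segment 0 ((1/2) *\<^sub>R f)"
      unfolding closed_segment_def using t(2) by (auto intro!: exI[of _ "2 * t f"])
    moreover have "(\<Sum>g\<in>V. t g *\<^sub>R g) \<in> half_zonotope V"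
      using t(2) by (auto simp: half_zonotope_def)
    ultimately show "z \<in> ?R" by (simp add: set_plus_intro)
  qed
  show "?R \<subseteq> ?L"
  proof (clarify elim!: set_plus_elim)
    fix x y assume x: "x \<in> closed_segment 0 ((1/2) *\<^sub>R f)" and y: "y \<in> half_zonotope V"
    from x obtain u where u: "x = u *\<^sub>R (1/2) *\<^sub>R f" "0 \<le> u" "u \<le> 1" by (auto simp: closed_segment_def)
    from y obtain t where t: "y = (\<Sum>g\<in>V. t g *\<^sub>R g)" "\<forall>g\<in>V. 0 \<le> t g \<and> t g \<le> 1/2"
      by (auto simp: half_zonotope_def)
    have "(\<Sum>g\<in>V. (t(f := u/2)) g *\<^sub>R g) = (\<Sum>g\<in>V. t g *\<^sub>R g)"
      using assms by (intro sum.cong) auto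
    then have "x + y = (\<Sum>g\<in>insert f V. (t(f := u/2)) g *\<^sub>R g)"
      using assms u t by simp
    moreover have "\<forall>g\<in>insert f V. 0 \<le> (t(f := u/2)) g \<and> (t(f := u/2)) g \<le> 1/2"
      using u t by auto
    ultimately show "x + y \<in> ?L" unfolding half_zonotope_def by blast
  qed
qed

lemma polytope_set_plus:
  fixes S T :: "'a::real_vector set"
  assumes "polytope S" "polytope T" shows "polytope (S + T)"
  using assms unfolding polytope_def by (metis convex_hull_set_plus finite_set_plus)

lemma polytope_half_zonotope:
  fixes V :: "'a::euclidean_space set"
  assumes "finite V" shows "polytope (half_zonotope V)"
  using assms
proof (induction V)
  case empty
  have "half_zonotope {} = {0::'a}" by (auto simp: half_zonotope_def)
  then show ?case by (simp add: polytope_sing)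
next
  case (insert f V)
  have "polytope (closed_segment 0 ((1/2) *\<^sub>R f))"
    unfolding polytope_def segment_convex_hull by (intro exI[of _ "{0, (1/2) *\<^sub>R f}"]) simp
  with insert show ?case by (simp add: half_zonotope_insert polytope_set_plus)
qed

text \<open>The midpoint of the face of the zonotope on which \<open>cross d\<close> is minimal.\<close>
definition face_mid :: "(real \<times> real) set \<Rightarrow> real \<times> real \<Rightarrow> real \<times> real" where
  "face_mid V d = (\<Sum>f\<in>{f\<in>V. cross d f < 0}. (1/2) *\<^sub>R f)"

lemma face_mid_alt:
  assumes "finite V"
  shows "face_mid V d = (\<Sum>f\<in>V. (if cross d f < 0 then 1/2 else 0) *\<^sub>R f)"
  unfolding face_mid_def by (rule sum.mono_neutral_cong_left) (use assms in auto)

text \<open>Each term t f (cross d f) is minimised separately: by t f = 1/2 if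
  \<open>cross d f\<close> is negative, by 0 if it is positive, and by any t f if it vanishes.
  \<open>D\<close> collects the deviations from this choice; each has nonnegative cross product with
  d, so equality forces all those products to vanish.\<close>

lemma half_zonotope_cross_ge:
  assumes "finite V" "x \<in> half_zonotope V"
  shows "cross d (face_mid V d) \<le> cross d x"
    and "cross d x = cross d (face_mid V d) \<Longrightarrow>
      \<exists>t. (\<forall>f. cross d f = 0 \<longrightarrow> f \<in> V \<longrightarrow> 0 \<le> t f \<and> t f \<le> 1/2) \<and>
        x = face_mid V d + (\<Sum>f\<in>{f\<in>V. cross d f = 0}. t f *\<^sub>R f)"
proof -
  from assms(2) obtain t where t: "x = (\<Sum>f\<in>V. t f *\<^sub>R f)" "\<forall>f\<in>V. 0 \<le> t f \<and> t f \<le> 1/2"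
    by (auto simp: half_zonotope_def)
  define D where "D = (\<lambda>f. (t f - (if cross d f < 0 then 1/2 else 0)) *\<^sub>R f)"
  have x: "x = face_mid V d + (\<Sum>f\<in>V. D f)"
    unfolding face_mid_alt[OF assms(1)] t(1) D_def by (simp add: scaleR_left_diff_distrib sum_subtractf)
  have D: "0 \<le> cross d (D f)" if "f \<in> V" for f
    using t(2) that by (auto simp: D_def mult_nonpos_nonpos)
  show "cross d (face_mid V d) \<le> cross d x"
    unfolding x cross_add cross_sum using D by (simp add: sum_nonneg)
  assume "cross d x = cross d (face_mid V d)"
  then have "(\<Sum>f\<in>V. cross d (D f)) = 0"
    unfolding x cross_add cross_sum by simp
  then have zero: "cross d (D f) = 0" if "f \<in> V" for f
    using D that assms(1) by (subst (asm) sum_nonneg_eq_0_iff) auto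
  then have "D f = 0" if "f \<in> V" "cross d f \<noteq> 0" for f
    using that(2) zero[OF that(1)] by (simp add: D_def)
  then have "(\<Sum>f\<in>V. D f) = (\<Sum>f\<in>{f\<in>V. cross d f = 0}. D f)"
    by (intro sum.mono_neutral_right) (auto simp: assms)
  also have "\<dots> = (\<Sum>f\<in>{f\<in>V. cross d f = 0}. t f *\<^sub>R f)"
    by (intro sum.cong) (auto simp: D_def)
  finally show "\<exists>t. (\<forall>f. cross d f = 0 \<longrightarrow> f \<in> V \<longrightarrow> 0 \<le> t f \<and> t f \<le> 1/2) \<and>
        x = face_mid V d + (\<Sum>f\<in>{f\<in>V. cross d f = 0}. t f *\<^sub>R f)"
    using x t(2) by auto
qed

lemma half_zonotope_face_mem:
  assumes "finite V" "\<And>f. f \<in> V \<Longrightarrow> cross d f = 0 \<Longrightarrow> 0 \<le> t f \<and> t f \<le> 1/2"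
  shows "face_mid V d + (\<Sum>f\<in>{f\<in>V. cross d f = 0}. t f *\<^sub>R f) \<in> half_zonotope V"
proof -
  define s where "s = (\<lambda>f. if cross d f = 0 then t f else if cross d f < 0 then 1/2 else 0)"
  have "(\<Sum>f\<in>{f\<in>V. cross d f = 0}. t f *\<^sub>R f) = (\<Sum>f\<in>V. (if cross d f = 0 then t f else 0) *\<^sub>R f)"
    by (rule sum.mono_neutral_cong_left) (use assms(1) in auto)
  then have "face_mid V d + (\<Sum>f\<in>{f\<in>V. cross d f = 0}. t f *\<^sub>R f) = (\<Sum>f\<in>V. s f *\<^sub>R f)"
    unfolding face_mid_alt[OF assms(1)]
    by (simp add: sum.distrib[symmetric] s_def scaleR_left_distrib[symmetric] del: scaleR_left_distrib)
       (auto intro!: sum.cong)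
  moreover have "\<forall>f\<in>V. 0 \<le> s f \<and> s f \<le> 1/2" using assms by (auto simp: s_def)
  ultimately show ?thesis unfolding half_zonotope_def by blast
qed

lemma aff_dim_closed_segment: "a \<noteq> b \<Longrightarrow> aff_dim (closed_segment a b) = 1" for a b :: "'a::euclidean_space"
  by (simp add: segment_convex_hull aff_dim_convex_hull)

text \<open>Symmetry centres the segments at the origin; \<open>parallel_V\<close> leaves one vector
  per direction, since vectors with equal direction would be fused into a single longer
  edge.\<close>

locale edge_vectors =
  fixes V :: "(real \<times> real) set"
  assumes finite_V: "finite V"
    and uminus_V: "f \<in> V \<Longrightarrow> - f \<in> V"
    and zero_V: "0 \<notin> V"
    and parallel_V: "e \<in> V \<Longrightarrow> f \<in> V \<Longrightarrow> cross e f = 0 \<Longrightarrow> f = e \<or> f = - e"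
begin

lemma parallel_set: "e \<in> V \<Longrightarrow> {f\<in>V. cross e f = 0} = {e, - e}"
  using parallel_V[of e] uminus_V[of e] by (intro equalityI subsetI) auto

lemma neq_uminus: "e \<in> V \<Longrightarrow> e \<noteq> - e"
  using zero_V by (metis add.inverse_inverse eq_neg_iff_add_eq_0 scaleR_2 scaleR_eq_0_iff zero_neq_numeral)

definition edge_src :: "real \<times> real \<Rightarrow> real \<times> real" where
  "edge_src e = face_mid V e - (1/2) *\<^sub>R e"

text \<open>On this face only the coefficients of e and - e are free, and their difference ranges
  over the interval from - 1/2 to 1/2.\<close>

lemma face_eq:
  assumes "e \<in> V"
  shows "half_zonotope V \<inter> {x. cross e x = cross e (face_mid V e)} = closed_segment (edge_src e) (edge_src e + e)"
    (is "?L = ?R")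
proof
  have *: "(\<Sum>f\<in>{f\<in>V. cross e f = 0}. t f *\<^sub>R f) = (t e - t (- e)) *\<^sub>R e" for t
    using assms neq_uminus[OF assms] by (simp add: parallel_set algebra_simps)
  show "?L \<subseteq> ?R"
  proof clarify
    fix a b assume ab: "(a, b) \<in> half_zonotope V" "cross e (a, b) = cross e (face_mid V e)"
    from half_zonotope_cross_ge(2)[OF finite_V ab] obtain t where
      t: "\<forall>f. cross e f = 0 \<longrightarrow> f \<in> V \<longrightarrow> 0 \<le> t f \<and> t f \<le> 1/2"
         "(a, b) = face_mid V e + (t e - t (- e)) *\<^sub>R e" unfolding * by blast
    have "0 \<le> t e \<and> t e \<le> 1/2 \<and> 0 \<le> t (- e) \<and> t (- e) \<le> 1/2"
      using t(1)[rule_format, of e] t(1)[rule_format, of "- e"] assms uminus_V by simp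
    moreover have "(a, b) = edge_src e + (1/2 + t e - t (- e)) *\<^sub>R e"
      unfolding t(2) edge_src_def by (simp add: algebra_simps)
    ultimately show "(a, b) \<in> ?R"
      unfolding closed_segment_def
      by (auto intro!: exI[of _ "1/2 + t e - t (- e)"] simp: algebra_simps)
  qed
  show "?R \<subseteq> ?L"
  proof
    fix x assume "x \<in> ?R"
    then obtain u where u: "x = edge_src e + u *\<^sub>R e" "0 \<le> u" "u \<le> 1"
      by (auto simp: closed_segment_def algebra_simps)
    have "x = face_mid V e + (\<Sum>f\<in>{f\<in>V. cross e f = 0}. (if f = e then u/2 else (1-u)/2) *\<^sub>R f)"
      unfolding * using u(1) neq_uminus[OF assms] by (auto simp: edge_src_def algebra_simps)
        (simp add: prod_eq_iff field_simps)
    moreover have "\<dots> \<in> half_zonotope V"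
      using u by (intro half_zonotope_face_mem finite_V) auto
    moreover have "cross e x = cross e (face_mid V e)"
      unfolding u(1) edge_src_def by (simp add: cross_add cross_diff)
    ultimately show "x \<in> ?L" by simp
  qed
qed

lemma face_face_of: "half_zonotope V \<inter> {x. cross d x = cross d (face_mid V d)} face_of half_zonotope V"
  unfolding cross_eq_inner
  by (rule face_of_Int_supporting_hyperplane_ge)
     (use polytope_half_zonotope[OF finite_V] half_zonotope_cross_ge(1)[OF finite_V] in
       \<open>auto simp: polytope_imp_convex cross_eq_inner\<close>)

lemma ccw_edge_half_zonotope:
  assumes "e \<in> V" shows "ccw_edge (half_zonotope V) (edge_src e) (edge_src e + e)"
  unfolding ccw_edge_iff edge_of_def
proof (intro conjI ballI)
  show "closed_segment (edge_src e) (edge_src e + e) face_of half_zonotope V"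
    using face_face_of[of e] unfolding face_eq[OF assms] .
  show "aff_dim (closed_segment (edge_src e) (edge_src e + e)) = 1"
    using assms zero_V by (intro aff_dim_closed_segment) auto
  fix x assume "x \<in> half_zonotope V"
  then show "0 \<le> cross (edge_src e + e - edge_src e) (x - edge_src e)"
    using half_zonotope_cross_ge(1)[OF finite_V, of x e] by (simp add: cross_diff edge_src_def)
qed

text \<open>Along an edge of direction d the functional \<open>cross d\<close> is minimal. If no
  vector of V were parallel to d, its minimal face would be a single point; so d is a positive
  multiple of some e in V, and the edge lies on the face of e.\<close>

lemma ccw_edge_half_zonotope_imp:
  assumes "ccw_edge (half_zonotope V) u v" shows "v - u \<in> V"
proof -
  define d where "d = v - u"
  let ?Z = "half_zonotope V"
  have seg: "closed_segment u v face_of ?Z" "aff_dim (closed_segment u v) = 1"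
    and left: "\<And>x. x \<in> ?Z \<Longrightarrow> 0 \<le> cross d (x - u)"
    using assms by (auto simp: ccw_edge_iff edge_of_def d_def)
  have uv: "u \<in> ?Z" "v \<in> ?Z" using face_of_imp_subset[OF seg(1)] by auto
  have "u \<noteq> v" using seg(2) by auto
  have mid: "face_mid V d \<in> ?Z"
    using half_zonotope_face_mem[OF finite_V, of d "\<lambda>_. 0"] by simp
  have cu: "cross d u = cross d (face_mid V d)"
    using left[OF mid] half_zonotope_cross_ge(1)[OF finite_V uv(1), of d] by (simp add: cross_diff)
  have cv: "cross d v = cross d (face_mid V d)"
    using cu cross_self[of d] cross_diff(1)[of d v u] by (simp add: d_def)
  have "\<exists>f\<in>V. cross d f = 0"
  proof (rule ccontr)
    assume "\<not> ?thesis"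
    then have E: "{f\<in>V. cross d f = 0} = {}" by blast
    have "u = face_mid V d" "v = face_mid V d"
      using half_zonotope_cross_ge(2)[OF finite_V uv(1) cu] half_zonotope_cross_ge(2)[OF finite_V uv(2) cv]
      unfolding E by auto
    then show False using \<open>u \<noteq> v\<close> by simp
  qed
  then obtain f where f: "f \<in> V" "cross d f = 0" by blast
  have "f \<noteq> 0" using f zero_V by auto
  have "\<exists>c. d = c *\<^sub>R f"
  proof (cases "fst f = 0")
    case True
    then have "snd f \<noteq> 0" using \<open>f \<noteq> 0\<close> by (auto simp: prod_eq_iff)
    then show ?thesis using f True by (intro exI[of _ "snd d / snd f"]) (auto simp: prod_eq_iff cross_def)
  next
    case False
    then show ?thesis using f by (intro exI[of _ "fst d / fst f"]) (auto simp: prod_eq_iff cross_def field_simps)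
  qed
  then obtain c where c: "d = c *\<^sub>R f" by blast
  have "c \<noteq> 0" using c \<open>u \<noteq> v\<close> by (auto simp: d_def)
  obtain e k where e: "e \<in> V" "d = k *\<^sub>R e" "k > 0"
  proof (cases "c > 0")
    case False
    then show ?thesis using that[of "- f" "- c"] c f(1) uminus_V \<open>c \<noteq> 0\<close> by auto
  qed (use that[of f c] c f(1) in simp)
  have "face_mid V d = face_mid V e"
    unfolding face_mid_def e(2) using e(3) by (simp add: mult_less_0_iff)
  then have "u \<in> ?Z \<inter> {x. cross e x = cross e (face_mid V e)}" "v \<in> ?Z \<inter> {x. cross e x = cross e (face_mid V e)}"
    using uv cu cv e by auto
  then have sub: "closed_segment u v \<subseteq> closed_segment (edge_src e) (edge_src e + e)"
    unfolding face_eq[OF e(1)] by (simp add: closed_segment_subset)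
  \<comment> \<open>A one-dimensional face of a segment is the whole segment, which fixes the length
    of the edge and not merely its direction.\<close>
  have "closed_segment u v face_of closed_segment (edge_src e) (edge_src e + e)"
    using face_of_subset[OF seg(1) sub] face_face_of[of e] unfolding face_eq[OF e(1)]
    by (simp add: face_of_imp_subset)
  then have "closed_segment u v = closed_segment (edge_src e) (edge_src e + e)"
    using face_of_aff_dim_lt[of "closed_segment (edge_src e) (edge_src e + e)" "closed_segment u v"] seg(2)
      aff_dim_closed_segment[of "edge_src e" "edge_src e + e"] e(1) zero_V
    by (metis add_cancel_left_right convex_closed_segment less_irrefl)
  then have "{u, v} = {edge_src e, edge_src e + e}" by simp
  then have "d = e \<or> d = - e" unfolding d_def by (auto simp: doubleton_eq_iff)
  then show ?thesis using e(1) uminus_V[OF e(1)] d_def by auto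
qed

lemma ccw_edges_half_zonotope: "{v - u | u v. ccw_edge (half_zonotope V) u v} = V"
proof (intro equalityI subsetI)
  fix e assume "e \<in> V"
  then show "e \<in> {v - u | u v. ccw_edge (half_zonotope V) u v}"
    using ccw_edge_half_zonotope[of e] by (intro CollectI exI[of _ "edge_src e"] exI[of _ "edge_src e + e"]) simp
qed (use ccw_edge_half_zonotope_imp in blast)

text \<open>Both sides are half the sum over one and the same set: the vectors to the right of e1
  together with e1 are the vectors to the right of e2 together with - e2, because no vector of V
  points strictly between e1 and e2.\<close>

lemma edge_src_consecutive:
  assumes e: "e1 \<in> V" "e2 \<in> V" "cross e1 e2 > 0"
    and adj: "\<And>f. f \<in> V \<Longrightarrow> \<not> (cross e1 f > 0 \<and> cross f e2 > 0)"
  shows "edge_src e1 + e1 = edge_src e2"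
proof -
  let ?N = "\<lambda>e. {f\<in>V. cross e f < 0}"
  have "insert e1 (?N e1) = insert (- e2) (?N e2)"
  proof (intro equalityI subsetI)
    fix f assume f: "f \<in> insert e1 (?N e1)"
    then have "f \<in> V" using e by auto
    show "f \<in> insert (- e2) (?N e2)"
    proof (cases "f = e1")
      case True
      then show ?thesis using e by (simp add: cross_commute[of e2 e1])
    next
      case False
      then have "cross e1 f < 0" using f by simp
      then have "\<not> cross e2 f > 0"
        using adj[OF uminus_V[OF \<open>f \<in> V\<close>]] by (simp add: cross_commute[of f e2])
      moreover have "f = - e2" if "cross e2 f = 0"
        using parallel_V[OF e(2) \<open>f \<in> V\<close> that] \<open>cross e1 f < 0\<close> e(3) by auto
      ultimately show ?thesis using \<open>f \<in> V\<close> by fastforce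
    qed
  next
    fix f assume f: "f \<in> insert (- e2) (?N e2)"
    then have "f \<in> V" using e(2) uminus_V[of e2] by auto
    show "f \<in> insert e1 (?N e1)"
    proof (cases "f = - e2")
      case True
      then show ?thesis using e uminus_V by simp
    next
      case False
      then have "cross e2 f < 0" using f by simp
      then have "\<not> cross e1 f > 0"
        using adj[OF \<open>f \<in> V\<close>] by (simp add: cross_commute[of f e2])
      moreover have "f = e1" if "cross e1 f = 0"
        using parallel_V[OF e(1) \<open>f \<in> V\<close> that] \<open>cross e2 f < 0\<close> e(3) by (auto simp: cross_commute[of e2 e1])
      ultimately show ?thesis using \<open>f \<in> V\<close> by fastforce
    qed
  qed
  moreover have "(\<Sum>f\<in>insert e1 (?N e1). (1/2) *\<^sub>R f) = (1/2) *\<^sub>R e1 + face_mid V e1"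
    unfolding face_mid_def using finite_V by (subst sum.insert) auto
  moreover have "(\<Sum>f\<in>insert (- e2) (?N e2). (1/2) *\<^sub>R f) = (1/2) *\<^sub>R (- e2) + face_mid V e2"
    unfolding face_mid_def using finite_V by (subst sum.insert) auto
  ultimately show ?thesis
    unfolding edge_src_def by (simp add: prod_eq_iff field_simps)
qed

text \<open>The set contains 0 and every e / 2, so the normal of a line containing it would be
  orthogonal to two independent vectors.\<close>

lemma aff_dim_half_zonotope:
  assumes "e1 \<in> V" "e2 \<in> V" "cross e1 e2 \<noteq> 0" shows "aff_dim (half_zonotope V) = 2"
proof (rule ccontr)
  have mem: "(\<Sum>f\<in>V. (if f = e then 1/2 else 0) *\<^sub>R f) \<in> half_zonotope V" for e
    unfolding half_zonotope_def by (intro CollectI exI conjI) auto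
  assume "aff_dim (half_zonotope V) \<noteq> 2"
  moreover have "aff_dim (half_zonotope V) \<le> 2" using aff_dim_le_DIM[of "half_zonotope V"] by simp
  ultimately have "aff_dim (half_zonotope V) < DIM(real \<times> real)" by simp
  then obtain a b where ab: "a \<noteq> 0" "half_zonotope V \<subseteq> {x. a \<bullet> x = b}"
    by (rule aff_lowdim_subset_hyperplane)
  have "0 \<in> half_zonotope V"
    unfolding half_zonotope_def by (intro CollectI exI[of _ "\<lambda>_. 0"]) auto
  then have "b = 0" using ab by auto
  have zero: "a \<bullet> e = 0" if "e \<in> V" for e
  proof -
    have "(\<Sum>f\<in>V. (if f = e then 1/2 else 0) *\<^sub>R f) = (\<Sum>f\<in>V. if f = e then (1/2) *\<^sub>R e else 0)"
      by (intro sum.cong) auto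
    also have "\<dots> = (1/2) *\<^sub>R e"
      using that finite_V by simp
    finally have "(\<Sum>f\<in>V. (if f = e then 1/2 else 0) *\<^sub>R f) = (1/2) *\<^sub>R e" .
    then have "(1/2) *\<^sub>R e \<in> half_zonotope V" using mem[of e] by simp
    then have "(1/2) *\<^sub>R e \<in> {x. a \<bullet> x = b}" using ab(2) by (rule rev_subsetD)
    then show ?thesis using \<open>b = 0\<close> by simp
  qed
  have "cross (snd a, - fst a) e = a \<bullet> e" for e by (simp add: cross_def inner_prod_def)
  then have "cross e1 (snd a, - fst a) = 0" "cross e2 (snd a, - fst a) = 0"
    using zero assms by (metis cross_commute neg_0_equal_iff_equal)+
  then have "(snd a, - fst a) = 0" using assms cross_eq_0_cancel by blast
  then show False using ab by (simp add: prod_eq_iff)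
qed

end

subsection \<open>The radius of curvature\<close>

definition circumradius :: "real \<times> real \<Rightarrow> real \<times> real \<Rightarrow> real" where
  "circumradius d e = norm d * norm e * norm (d + e) / (2 * cross d e)"

text \<open>Seen from the centre, the middle vertex x has inner products with d and e that are fixed
  by equidistance. As d and e form a basis, these determine the norm of x; \<open>gram\<close> is
  the formula, with the squared cross product as Gram determinant.\<close>

lemma circumradius_unique:
  assumes "{u, u + d, u + d + e} \<subseteq> sphere c r" "cross d e > 0"
  shows "r = circumradius d e"
proof -
  define x where "x = u + d - c"
  have r: "norm x = r" "norm (x - d) = r" "norm (x + e) = r"
    using assms(1) by (auto simp: x_def dist_norm norm_minus_commute algebra_simps)
  then have "r \<ge> 0" by auto
  have "(x - d) \<bullet> (x - d) = x \<bullet> x" "(x + e) \<bullet> (x + e) = x \<bullet> x"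
    unfolding power2_norm_eq_inner[symmetric] r by simp_all
  then have xd: "2 * (x \<bullet> d) = d \<bullet> d" and xe: "2 * (x \<bullet> e) = - (e \<bullet> e)"
    by (simp_all add: inner_diff inner_add inner_commute)
  have gram: "(x \<bullet> x) * (cross d e)^2
      = (x \<bullet> d)^2 * (e \<bullet> e) - 2 * (x \<bullet> d) * (x \<bullet> e) * (d \<bullet> e) + (x \<bullet> e)^2 * (d \<bullet> d)"
    unfolding cross_def inner_prod_def inner_real_def by algebra
  have "x \<bullet> d = (d \<bullet> d) / 2" "x \<bullet> e = - (e \<bullet> e) / 2" using xd xe by auto
  then have "(x \<bullet> x) * (cross d e)^2 = (d \<bullet> d) * (e \<bullet> e) * ((d + e) \<bullet> (d + e)) / 4"
    unfolding gram inner_add_left inner_add_right inner_commute[of e d]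
    by (simp only: power2_eq_square) (simp add: field_simps)
  then have "(r * cross d e)^2 = (norm d * norm e * norm (d + e) / 2)^2"
    by (simp add: power_mult_distrib power_divide r(1)[symmetric] power2_norm_eq_inner)
  then have "r * cross d e = norm d * norm e * norm (d + e) / 2"
    using \<open>r \<ge> 0\<close> assms(2) by (simp add: power2_eq_iff_nonneg)
  then show ?thesis
    using assms(2) by (simp add: circumradius_def field_simps)
qed

lemma circumradius_exists:
  assumes "cross d e > 0"
  shows "\<exists>c. {u, u + d, u + d + e} \<subseteq> sphere c (circumradius d e)"
proof -
  \<comment> \<open>Solution of the linear system 2 (x . d) = d . d and 2 (x . e) = - (e . e): the
    two rotated vectors are orthogonal to e and to d, respectively.\<close>
  define x where "x = (1 / (2 * cross d e)) *\<^sub>R ((d \<bullet> d) *\<^sub>R (snd e, - fst e) + (e \<bullet> e) *\<^sub>R (snd d, - fst d))"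
  have "x \<bullet> d = (1 / (2 * cross d e)) * ((d \<bullet> d) * cross d e)"
    unfolding x_def inner_scaleR_left by (simp add: inner_prod_def cross_def) (simp add: algebra_simps)
  then have xd: "2 * (x \<bullet> d) = d \<bullet> d" using assms by simp
  have "x \<bullet> e = (1 / (2 * cross d e)) * (- (e \<bullet> e) * cross d e)"
    unfolding x_def inner_scaleR_left by (simp add: inner_prod_def cross_def) (simp add: algebra_simps)
  then have xe: "2 * (x \<bullet> e) = - (e \<bullet> e)" using assms by simp
  have "(norm (x - d))^2 = (norm x)^2" "(norm (x + e))^2 = (norm x)^2"
    using xd xe unfolding power2_norm_eq_inner by (simp_all add: inner_diff inner_add inner_commute)
  then have "norm (x - d) = norm x" "norm (x + e) = norm x"
    by (simp_all add: power2_eq_iff_nonneg)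
  then have sub: "{u, u + d, u + d + e} \<subseteq> sphere (u + d - x) (norm x)"
    by (auto simp: dist_norm norm_minus_commute algebra_simps)
  then show ?thesis
    using circumradius_unique[OF sub assms] by metis
qed

section \<open>Vertices and radii of the Jarnik polygon\<close>

definition jarnik_edges :: "nat \<Rightarrow> (real \<times> real) set" where
  "jarnik_edges Q = (\<lambda>(q, a). (real_of_int q, real_of_int a)) ` jarnik_vectors Q"

lemma jarnik_edgesE:
  assumes "f \<in> jarnik_edges Q"
  obtains q a :: int where "f = (real_of_int q, real_of_int a)" "gcd q a = 1" "\<bar>q\<bar> \<le> int Q" "\<bar>a\<bar> \<le> int Q"
  using assms by (auto simp: jarnik_edges_def jarnik_vectors_def)

lemma jarnik_edgesI:
  "gcd q a = 1 \<Longrightarrow> \<bar>q\<bar> \<le> int Q \<Longrightarrow> \<bar>a\<bar> \<le> int Q \<Longrightarrow> (real_of_int q, real_of_int a) \<in> jarnik_edges Q"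
  by (auto simp: jarnik_edges_def jarnik_vectors_def image_iff)

lemma coprime_cross_eq_0:
  fixes q a r b :: int
  assumes "gcd q a = 1" "gcd r b = 1" "q * b = a * r"
  shows "(r, b) = (q, a) \<or> (r, b) = (- q, - a)"
proof -
  have "coprime q a" "coprime r b" using assms by (auto simp: coprime_iff_gcd_eq_1)
  have "q dvd r" using assms(3) \<open>coprime q a\<close> by (metis coprime_dvd_mult_right_iff dvd_triv_left)
  moreover have "r dvd q" using assms(3) \<open>coprime r b\<close> by (metis coprime_dvd_mult_left_iff dvd_triv_right)
  ultimately have "\<bar>r\<bar> = \<bar>q\<bar>" using zdvd_antisym_abs by blast
  then have rq: "r = q \<or> r = - q" by linarith
  show ?thesis
  proof (cases "q = 0")
    case True
    then have "r = 0" "\<bar>a\<bar> = 1" "\<bar>b\<bar> = 1" using rq assms by auto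
    then show ?thesis using True by auto
  next
    case False
    then show ?thesis using rq assms(3) mult_left_cancel[of q b "- a"] mult_left_cancel[of q b a]
      by (auto simp: mult.commute[of a])
  qed
qed

interpretation jarnik: edge_vectors "jarnik_edges Q"
proof
  have "jarnik_vectors Q \<subseteq> {- int Q..int Q} \<times> {- int Q..int Q}"
    by (auto simp: jarnik_vectors_def)
  then have "finite (jarnik_vectors Q)" using finite_subset by blast
  then show "finite (jarnik_edges Q)" by (simp add: jarnik_edges_def)
  show "- f \<in> jarnik_edges Q" if "f \<in> jarnik_edges Q" for f
  proof -
    from that obtain q a where *: "f = (real_of_int q, real_of_int a)" "gcd q a = 1" "\<bar>q\<bar> \<le> int Q" "\<bar>a\<bar> \<le> int Q"
      by (rule jarnik_edgesE)
    then show ?thesis using jarnik_edgesI[of "- q" "- a" Q] by simp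
  qed
  show "0 \<notin> jarnik_edges Q"
    by (auto simp: jarnik_edges_def jarnik_vectors_def zero_prod_def)
  \<comment> \<open>Primitivity enters here: parallel primitive integer vectors agree up to
    sign.\<close>
  show "f = e \<or> f = - e" if "e \<in> jarnik_edges Q" "f \<in> jarnik_edges Q" "cross e f = 0" for e f
  proof -
    from that(1) obtain q a where e: "e = (real_of_int q, real_of_int a)" "gcd q a = 1"
      by (rule jarnik_edgesE)
    from that(2) obtain r b where f: "f = (real_of_int r, real_of_int b)" "gcd r b = 1"
      by (rule jarnik_edgesE)
    have "real_of_int (q * b) = real_of_int (a * r)" using that(3) unfolding e f cross_def by simp
    then have "q * b = a * r" by linarith
    from coprime_cross_eq_0[OF e(2) f(2) this] show ?thesis by (auto simp: e f)
  qed
qed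

lemma jarnik_polygon_iff:
  "jarnik_polygon Q P \<longleftrightarrow>
    polytope P \<and> aff_dim P = 2 \<and> {v - u | u v. ccw_edge P u v} = jarnik_edges Q"
  by (simp only: jarnik_polygon_def jarnik_edges_def)

lemma jarnik_polygon_half_zonotope:
  assumes "Q \<ge> 1" shows "jarnik_polygon Q (half_zonotope (jarnik_edges Q))"
proof -
  have "(1, 0) \<in> jarnik_edges Q" "(0, 1) \<in> jarnik_edges Q"
    using jarnik_edgesI[of 1 0 Q] jarnik_edgesI[of 0 1 Q] assms by simp_all
  then have "aff_dim (half_zonotope (jarnik_edges Q)) = 2"
    by (rule jarnik.aff_dim_half_zonotope) (simp add: cross_def)
  then show ?thesis
    unfolding jarnik_polygon_iff using jarnik.ccw_edges_half_zonotope polytope_half_zonotope jarnik.finite_V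
    by blast
qed

lemma slope_less_iff: "fst d > 0 \<Longrightarrow> fst e > 0 \<Longrightarrow> slope d < slope e \<longleftrightarrow> cross d e > 0"
  by (simp add: slope_def cross_def field_simps)

text \<open>An edge with direction strictly between two consecutive ones would have to collapse to
  their common vertex.\<close>
lemma vertex_at_slope_consecutive:
  assumes P: "jarnik_polygon Q P" and v: "vertex_at_slope P mu u v w"
    and f: "f \<in> jarnik_edges Q" "cross (v - u) f > 0" "cross f (w - v) > 0"
  shows False
proof -
  define d e where "d = v - u" and "e = w - v"
  have d: "\<And>x. x \<in> P \<Longrightarrow> 0 \<le> cross d (x - v)"
    and e: "\<And>x. x \<in> P \<Longrightarrow> 0 \<le> cross e (x - v)"
  proof -
    fix x assume "x \<in> P"
    then have "0 \<le> cross d (x - u)" "0 \<le> cross e (x - v)"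
      using v by (auto simp: vertex_at_slope_def ccw_edge_iff d_def e_def)
    moreover have "cross d (x - u) = cross d (x - v) + cross d d"
      unfolding cross_add(1)[symmetric] by (simp add: d_def)
    ultimately show "0 \<le> cross d (x - v)" "0 \<le> cross e (x - v)" by simp_all
  qed
  have "cross d e > 0"
    using v slope_less_iff[of d e] by (simp add: vertex_at_slope_def d_def e_def)
  have vP: "v \<in> P"
    using v edge_of_imp_subset by (fastforce simp: vertex_at_slope_def ccw_edge_def)
  have "f \<in> {v - u | u v. ccw_edge P u v}"
    using f(1) P unfolding jarnik_polygon_iff by blast
  then obtain a b where ab: "ccw_edge P a b" "f = b - a" by blast
  have abP: "a \<in> P" "b \<in> P"
    using ab(1) edge_of_imp_subset by (fastforce simp: ccw_edge_def)+
  \<comment> \<open>As f is a positive combination of d and e, whose functionals are both minimal on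
    P at v, the functional of f is minimal there and nowhere else.\<close>
  have fx: "x = v" if "x \<in> P" "0 \<le> cross f (v - x)" for x
  proof -
    have "cross d e * cross f (x - v) = cross (cross d e *\<^sub>R f) (x - v)" by simp
    also have "\<dots> = cross f e * cross d (x - v) + cross d f * cross e (x - v)"
      unfolding cross_decomp[of d e f] cross_add by simp
    finally have eq: "cross d e * cross f (x - v) = cross f e * cross d (x - v) + cross d f * cross e (x - v)" .
    moreover have "cross d e * cross f (x - v) \<le> 0"
      using that(2) \<open>cross d e > 0\<close> by (simp add: cross_diff mult_nonneg_nonpos)
    moreover have "0 \<le> cross f e * cross d (x - v)" "0 \<le> cross d f * cross e (x - v)"
      using d[OF that(1)] e[OF that(1)] f by (simp_all add: d_def e_def)
    ultimately have "cross f e * cross d (x - v) = 0" "cross d f * cross e (x - v) = 0" by linarith+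
    then have "cross d (x - v) = 0" "cross e (x - v) = 0"
      using f by (simp_all add: d_def e_def)
    then show ?thesis using cross_eq_0_cancel[of d "x - v" e] \<open>cross d e > 0\<close> by simp
  qed
  have "0 \<le> cross f (v - a)" using ab vP by (simp add: ccw_edge_iff)
  moreover have "cross f (v - b) = cross f (v - a) - cross f f"
    unfolding cross_diff(1)[symmetric] by (simp add: ab(2))
  ultimately have "a = v" "b = v" using fx abP by simp_all
  then show False using ab(2) f(1) jarnik.zero_V by simp
qed

text \<open>The half zonotope shows that the description is satisfied. In any other Jarnik polygon
  the two edges around mu also have no edge direction strictly between them, which forces them to be
  d and e, and three points determine the radius.\<close>

lemma curv_radius_eq_circumradius:
  assumes Q: "Q \<ge> 1" and de: "d \<in> jarnik_edges Q" "e \<in> jarnik_edges Q" "fst d > 0" "fst e > 0"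
    and mu: "slope d < mu" "mu < slope e"
    and adj: "\<And>f. f \<in> jarnik_edges Q \<Longrightarrow> \<not> (cross d f > 0 \<and> cross f e > 0)"
  shows "curv_radius Q mu = circumradius d e"
  unfolding curv_radius_def
proof (rule the_equality)
  have de0: "cross d e > 0" using slope_less_iff[of d e] de mu by simp
  let ?P = "half_zonotope (jarnik_edges Q)"
  let ?u = "jarnik.edge_src Q d"
  have v: "?u + d = jarnik.edge_src Q e"
    using jarnik.edge_src_consecutive[OF de(1,2) de0 adj] .
  have "ccw_edge ?P ?u (?u + d)" "ccw_edge ?P (?u + d) (?u + d + e)"
    using jarnik.ccw_edge_half_zonotope[OF de(1)] jarnik.ccw_edge_half_zonotope[OF de(2)] v by simp_all
  then have "vertex_at_slope ?P mu ?u (?u + d) (?u + d + e)"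
    using de mu by (simp add: vertex_at_slope_def)
  then show "\<exists>P u v w c. jarnik_polygon Q P \<and> vertex_at_slope P mu u v w \<and>
      {u, v, w} \<subseteq> sphere c (circumradius d e)"
    using circumradius_exists[OF de0, of ?u] jarnik_polygon_half_zonotope[OF Q] by blast
next
  fix r assume "\<exists>P u v w c. jarnik_polygon Q P \<and> vertex_at_slope P mu u v w \<and> {u, v, w} \<subseteq> sphere c r"
  then obtain P u v w c where *: "jarnik_polygon Q P" "vertex_at_slope P mu u v w" "{u, v, w} \<subseteq> sphere c r"
    by blast
  define d' e' where "d' = v - u" and "e' = w - v"
  have "d' \<in> {v - u | u v. ccw_edge P u v}" "e' \<in> {v - u | u v. ccw_edge P u v}"
    using *(2) unfolding vertex_at_slope_def d'_def e'_def by blast+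
  then have V: "d' \<in> jarnik_edges Q" "e' \<in> jarnik_edges Q"
    using *(1) unfolding jarnik_polygon_iff by blast+
  have fst: "fst d' > 0" "fst e' > 0" and s: "slope d' < mu" "mu < slope e'"
    using *(2) by (simp_all add: vertex_at_slope_def d'_def e'_def)
  have adj': "\<not> (cross d' f > 0 \<and> cross f e' > 0)" if "f \<in> jarnik_edges Q" for f
    using vertex_at_slope_consecutive[OF *(1,2) that] unfolding d'_def e'_def by blast
  have pos: "cross d e' > 0" "cross d' e > 0" "cross d' e' > 0"
    using slope_less_iff[of d e'] slope_less_iff[of d' e] slope_less_iff[of d' e'] de(3,4) fst s mu
    by simp_all
  \<comment> \<open>If d' were to the left of d, it would lie strictly between d and e; if to the
    right, d would lie strictly between d' and e'.\<close>
  have "cross d d' = 0"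
    using adj[OF V(1)] adj'[OF de(1)] pos cross_commute[of d d'] by auto
  then have "d' = d" using jarnik.parallel_V[OF de(1) V(1)] fst de by auto
  have "cross e e' = 0"
    using adj[OF V(2)] adj'[OF de(2)] pos cross_commute[of e e'] by auto
  then have "e' = e" using jarnik.parallel_V[OF de(2) V(2)] fst de by auto
  have "v = u + d" "w = u + d + e" using \<open>d' = d\<close> \<open>e' = e\<close> by (auto simp: d'_def e'_def)
  then show "r = circumradius d e"
    using circumradius_unique[of u d e c r] *(3) pos \<open>d' = d\<close> \<open>e' = e\<close> by simp
qed

lemma norm_jarnik_edge_le:
  assumes "f \<in> jarnik_edges Q" shows "norm f \<le> 2 * real Q"
proof -
  from assms obtain q a where f: "f = (real_of_int q, real_of_int a)" "\<bar>q\<bar> \<le> int Q" "\<bar>a\<bar> \<le> int Q"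
    by (rule jarnik_edgesE)
  have "norm f \<le> norm (real_of_int q) + norm (real_of_int a)"
    unfolding f(1) by (rule norm_Pair_le)
  also have "\<dots> \<le> real Q + real Q"
    using of_int_le_iff[where ?'a = real, of "\<bar>q\<bar>" "int Q"] of_int_le_iff[where ?'a = real, of "\<bar>a\<bar>" "int Q"] f
    by simp
  finally show ?thesis by simp
qed

lemma cross_jarnik_edges_ge_1:
  assumes "d \<in> jarnik_edges Q" "e \<in> jarnik_edges Q" "cross d e > 0" shows "cross d e \<ge> 1"
proof -
  from assms(1) obtain q a where d: "d = (real_of_int q, real_of_int a)" by (rule jarnik_edgesE)
  from assms(2) obtain r b where e: "e = (real_of_int r, real_of_int b)" by (rule jarnik_edgesE)
  have eq: "cross d e = real_of_int (q * b - a * r)" by (simp add: d e cross_def)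
  then have "q * b - a * r > 0" using assms(3) by (metis of_int_0_less_iff)
  then show ?thesis unfolding eq by linarith
qed

text \<open>An integral positive determinant is at least 1, and two of the three norms are O(Q). One
  norm is kept so that the bound becomes quadratic in Q when that edge does not vary.\<close>

lemma circumradius_le:
  assumes "d \<in> jarnik_edges Q" "e \<in> jarnik_edges Q" "cross d e > 0"
  shows "0 \<le> circumradius d e" and "circumradius d e \<le> 4 * (real Q)^2 * norm d"
    and "circumradius d e \<le> 4 * (real Q)^2 * norm e"
proof -
  have c: "cross d e \<ge> 1" using cross_jarnik_edges_ge_1 assms by blast
  show "0 \<le> circumradius d e" using assms by (simp add: circumradius_def)
  have n: "norm d \<le> 2 * real Q" "norm e \<le> 2 * real Q" using norm_jarnik_edge_le assms by blast+
  have de: "norm (d + e) \<le> 4 * real Q" using norm_triangle_ineq[of d e] n by linarith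
  have "circumradius d e \<le> norm d * norm e * norm (d + e) / 2"
    unfolding circumradius_def using c by (intro divide_left_mono) auto
  moreover have "norm d * norm e * norm (d + e) \<le> norm d * (2 * real Q) * (4 * real Q)"
    using n de by (intro mult_mono) auto
  moreover have "norm d * norm e * norm (d + e) \<le> (2 * real Q) * norm e * (4 * real Q)"
    using n de by (intro mult_mono) auto
  ultimately show "circumradius d e \<le> 4 * (real Q)^2 * norm d" "circumradius d e \<le> 4 * (real Q)^2 * norm e"
    by (simp_all add: power2_eq_square mult_ac)
qed

section \<open>One-sided radii at rational slopes\<close>

lemma exists_irrational_between:
  fixes x y :: real assumes "x < y" obtains z where "x < z" "z < y" "z \<notin> \<rat>"
proof -
  have "\<not> {x<..<y} \<subseteq> \<rat>"
    using uncountable_open_interval[of x y] countable_rat countable_subset assms by blast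
  then show ?thesis using that by (meson greaterThanLessThan_iff subsetI)
qed

text \<open>The eventual condition speaks about irrational points only; it determines the value
  because such points occur frequently.\<close>

lemma the_eventually_irrational:
  fixes F :: "real filter"
  assumes "\<exists>\<^sub>F x in F. x \<notin> \<rat>" and r: "\<forall>\<^sub>F x in F. x \<notin> \<rat> \<longrightarrow> f x = r"
  shows "(THE s. \<forall>\<^sub>F x in F. x \<notin> \<rat> \<longrightarrow> f x = s) = r"
proof (rule the_equality)
  fix s assume "\<forall>\<^sub>F x in F. x \<notin> \<rat> \<longrightarrow> f x = s"
  with r have "\<forall>\<^sub>F x in F. x \<notin> \<rat> \<longrightarrow> f x = r \<and> f x = s"
    by eventually_elim auto
  then show "s = r" using frequently_ex[OF frequently_eventually_conj[OF assms(1)]] by blast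
qed (rule r)

lemma frequently_irrational_at_right: "\<exists>\<^sub>F x in at_right (a::real). x \<notin> \<rat>"
  unfolding frequently_def eventually_at_right_field
  by (metis exists_irrational_between)

lemma frequently_irrational_at_left: "\<exists>\<^sub>F x in at_left (a::real). x \<notin> \<rat>"
  unfolding frequently_def eventually_at_left_field
  by (metis exists_irrational_between)

text \<open>By \<open>cross_decomp\<close>, f is a positive combination of d and e. So an edge
  between them has positive abscissa and can be compared by slope.\<close>

lemma fst_pos_between:
  assumes "cross d f > 0" "cross f e > 0" "cross d e > 0" "fst d > 0" "fst e > 0"
  shows "fst f > 0"
proof -
  have "cross d e * fst f = cross f e * fst d + cross d f * fst e"
    using cross_decomp[of d e f] by (simp add: prod_eq_iff)
  moreover have "cross f e * fst d > 0" "cross d f * fst e > 0" using assms by simp_all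
  ultimately have "cross d e * fst f > 0" by linarith
  then show ?thesis using assms(3) by (simp add: zero_less_mult_iff)
qed

text \<open>Take for e the edge of least slope above that of d. For every mu between the two slopes
  the vertex is where d meets e, so d stays incident to it.\<close>

lemma curv_radius_right_vertex:
  assumes Q: "Q \<ge> 2" and d: "d \<in> jarnik_edges Q" "fst d > 0" "slope d < 2"
  shows "\<exists>e\<in>jarnik_edges Q. cross d e > 0 \<and> curv_radius_right Q (slope d) = circumradius d e"
proof -
  define A where "A = {f \<in> jarnik_edges Q. fst f > 0 \<and> slope d < slope f}"
  have "finite A" unfolding A_def using jarnik.finite_V by auto
  \<comment> \<open>Some edge is steeper than d; this vector has a coordinate 2, whence the
    requirement on Q.\<close>
  moreover have "(1, 2) \<in> A"
    using jarnik_edgesI[of 1 2 Q] Q d(3) by (simp add: A_def slope_def)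
  ultimately obtain e where e: "e \<in> A" "\<And>f. f \<in> A \<Longrightarrow> slope e \<le> slope f"
    by (metis arg_min_if_finite(1,2) empty_iff not_le_imp_less)
  have eE: "e \<in> jarnik_edges Q" "fst e > 0" "slope d < slope e" using e(1) by (auto simp: A_def)
  have de: "cross d e > 0" using slope_less_iff d eE by blast
  have adj: "\<not> (cross d f > 0 \<and> cross f e > 0)" if "f \<in> jarnik_edges Q" for f
  proof
    assume f: "cross d f > 0 \<and> cross f e > 0"
    then have "fst f > 0" using fst_pos_between de d eE by blast
    then have "f \<in> A" "slope f < slope e"
      using f that slope_less_iff d eE by (auto simp: A_def)
    then show False using e(2) by fastforce
  qed
  have "\<forall>\<^sub>F x in at_right (slope d). x \<notin> \<rat> \<longrightarrow> curv_radius Q x = circumradius d e"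
    unfolding eventually_at_right_field
    using curv_radius_eq_circumradius[OF _ d(1) eE(1) d(2) eE(2) _ _ adj] Q eE(3) by fastforce
  then have "curv_radius_right Q (slope d) = circumradius d e"
    unfolding curv_radius_right_def
    by (rule the_eventually_irrational[OF frequently_irrational_at_right])
  then show ?thesis using eE de by blast
qed

lemma curv_radius_left_vertex:
  assumes Q: "Q \<ge> 2" and e: "e \<in> jarnik_edges Q" "fst e > 0" "- 1 < slope e"
  shows "\<exists>d\<in>jarnik_edges Q. cross d e > 0 \<and> curv_radius_left Q (slope e) = circumradius d e"
proof -
  define A where "A = {f \<in> jarnik_edges Q. fst f > 0 \<and> slope f < slope e}"
  have "finite A" unfolding A_def using jarnik.finite_V by auto
  moreover have "(1, - 1) \<in> A"
    using jarnik_edgesI[of 1 "- 1" Q] Q e(3) by (simp add: A_def slope_def)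
  ultimately obtain d where d: "d \<in> A" "\<And>f. f \<in> A \<Longrightarrow> slope f \<le> slope d"
    using Max_in[of "slope ` A"] Max_ge[of "slope ` A"] by fastforce
  have dE: "d \<in> jarnik_edges Q" "fst d > 0" "slope d < slope e" using d(1) by (auto simp: A_def)
  have de: "cross d e > 0" using slope_less_iff e dE by blast
  have adj: "\<not> (cross d f > 0 \<and> cross f e > 0)" if "f \<in> jarnik_edges Q" for f
  proof
    assume f: "cross d f > 0 \<and> cross f e > 0"
    then have "fst f > 0" using fst_pos_between de e dE by blast
    then have "f \<in> A" "slope d < slope f"
      using f that slope_less_iff e dE by (auto simp: A_def)
    then show False using d(2) by fastforce
  qed
  have "\<forall>\<^sub>F x in at_left (slope e). x \<notin> \<rat> \<longrightarrow> curv_radius Q x = circumradius d e"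
    unfolding eventually_at_left_field
    using curv_radius_eq_circumradius[OF _ dE(1) e(1) dE(2) e(2) _ _ adj] Q dE(3) by fastforce
  then have "curv_radius_left Q (slope e) = circumradius d e"
    unfolding curv_radius_left_def
    by (rule the_eventually_irrational[OF frequently_irrational_at_left])
  then show ?thesis using dE de by blast
qed

lemma eventually_scale_factor_pos: "\<forall>\<^sub>F Q in sequentially. scale_factor Q > 0"
proof -
  have "\<forall>\<^sub>F Q in sequentially. scale_factor Q / real Q ^ 3 > 0"
    using order_tendstoD(1)[OF scale_factor_asymptotic, of 0] by simp
  then show ?thesis by eventually_elim (auto simp: zero_less_divide_iff)
qed

lemma quadratic_over_scale_factor: "(\<lambda>Q. C * (real Q)^2 / scale_factor Q) \<longlonglongrightarrow> 0"
proof -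
  have "(\<lambda>Q. (C * (1 / real Q)) / (scale_factor Q / real Q ^ 3)) \<longlonglongrightarrow> (C * 0) / (3 / pi^2)"
    by (intro tendsto_intros lim_1_over_n scale_factor_asymptotic) simp
  moreover have "(C * (1 / real Q)) / (scale_factor Q / real Q ^ 3) = C * (real Q)^2 / scale_factor Q" for Q
    by (cases "Q = 0") (simp_all add: power2_eq_square power3_eq_cube)
  ultimately show ?thesis by simp
qed

lemma rational_slope:
  assumes "lam \<in> \<rat>" "0 \<le> lam" "lam \<le> 1"
  obtains d where "fst d > 0" "slope d = lam" "\<forall>\<^sub>F Q in sequentially. d \<in> jarnik_edges Q"
proof -
  from assms(1) obtain a q :: int where aq: "q > 0" "coprime a q" "lam = of_int a / of_int q"
    by (rule Rats_cases')
  have g: "gcd q a = 1" using aq(2) by (simp add: coprime_iff_gcd_eq_1 gcd.commute)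
  have "\<forall>\<^sub>F Q in sequentially. (real_of_int q, real_of_int a) \<in> jarnik_edges Q"
    using eventually_ge_at_top[of "nat (\<bar>q\<bar> + \<bar>a\<bar>)"]
    by eventually_elim (intro jarnik_edgesI g; simp add: nat_le_iff)
  then show ?thesis using that[of "(real_of_int q, real_of_int a)"] aq by (simp add: slope_def)
qed

lemma scaled_radius_rational:
  assumes "lam \<in> \<rat>" "0 \<le> lam" "lam \<le> 1"
  shows "(\<lambda>Q. scaled_radius_right Q lam) \<longlonglongrightarrow> 0" "(\<lambda>Q. scaled_radius_left Q lam) \<longlonglongrightarrow> 0"
proof -
  obtain d where d: "fst d > 0" "slope d = lam" "\<forall>\<^sub>F Q in sequentially. d \<in> jarnik_edges Q"
    using rational_slope assms by blast
  have s: "slope d < 2" "-1 < slope d" using d assms by auto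
  have squeeze: "(\<lambda>Q. r Q / scale_factor Q) \<longlonglongrightarrow> 0"
    if "\<forall>\<^sub>F Q in sequentially. 0 \<le> r Q \<and> r Q \<le> 4 * (real Q)^2 * norm d" for r
  proof (rule tendsto_sandwich)
    show "\<forall>\<^sub>F Q in sequentially. 0 \<le> r Q / scale_factor Q"
      using that eventually_scale_factor_pos by eventually_elim auto
    show "\<forall>\<^sub>F Q in sequentially. r Q / scale_factor Q \<le> (4 * norm d) * (real Q)^2 / scale_factor Q"
      using that eventually_scale_factor_pos
      by eventually_elim (auto intro!: divide_right_mono simp: mult_ac)
  qed (use quadratic_over_scale_factor in auto)
  have "\<forall>\<^sub>F Q in sequentially. 0 \<le> curv_radius_right Q lam \<and> curv_radius_right Q lam \<le> 4 * (real Q)^2 * norm d"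
    using d(3) eventually_ge_at_top[of 2]
  proof eventually_elim
    case (elim Q)
    then show ?case using curv_radius_right_vertex[OF elim(2,1) d(1) s(1)] circumradius_le d(2) elim(1) by metis
  qed
  then show "(\<lambda>Q. scaled_radius_right Q lam) \<longlonglongrightarrow> 0"
    unfolding scaled_radius_right_def by (rule squeeze)
  have "\<forall>\<^sub>F Q in sequentially. 0 \<le> curv_radius_left Q lam \<and> curv_radius_left Q lam \<le> 4 * (real Q)^2 * norm d"
    using d(3) eventually_ge_at_top[of 2]
  proof eventually_elim
    case (elim Q)
    then show ?case using curv_radius_left_vertex[OF elim(2,1) d(1) s(2)] circumradius_le d(2) elim(1) by metis
  qed
  then show "(\<lambda>Q. scaled_radius_left Q lam) \<longlonglongrightarrow> 0"
    unfolding scaled_radius_left_def by (rule squeeze)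
qed

subsection \<open>Farey pairs\<close>

text \<open>Adjacency in the Farey sequence of order Q, encoded without the sequence: determinant 1,
  and a mediant whose denominator q + r exceeds Q.\<close>

definition farey_pair :: "real \<Rightarrow> nat \<Rightarrow> int \<Rightarrow> int \<Rightarrow> int \<Rightarrow> int \<Rightarrow> bool" where
  "farey_pair lam Q q a r b \<longleftrightarrow> 1 \<le> q \<and> q \<le> int Q \<and> 1 \<le> r \<and> r \<le> int Q \<and> int Q < q + r \<and>
     q * b - a * r = 1 \<and> of_int a < lam * of_int q \<and> lam * of_int r < of_int b"

definition farey_ratio :: "nat \<Rightarrow> int \<Rightarrow> int \<Rightarrow> real" where
  "farey_ratio Q q r = of_int q * of_int r * (of_int q + of_int r) / real Q ^ 3"

lemma irrational_neq_fraction: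
  assumes "lam \<notin> \<rat>" "q \<noteq> 0" shows "lam * of_int q \<noteq> of_int a"
proof
  assume "lam * of_int q = of_int a"
  then have "lam = of_int a / of_int q" using assms(2) by (simp add: field_simps)
  then show False using assms(1) by simp
qed

text \<open>Raising the order changes the pair only when the new order is q + r. Then the mediant
  replaces the neighbour on its own side of lam, and irrationality excludes equality.\<close>

lemma farey_pair_exists:
  assumes "0 < lam" "lam < 1" "lam \<notin> \<rat>" "Q \<ge> 1"
  shows "\<exists>q a r b. farey_pair lam Q q a r b"
  using assms(4)
proof (induction Q rule: dec_induct)
  case base
  have "farey_pair lam 1 1 0 1 1" using assms by (simp add: farey_pair_def)
  then show ?case by blast
next
  case (step Q)
  then obtain q a r b where f: "farey_pair lam Q q a r b" by blast
  show ?case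
  proof (cases "int (Suc Q) < q + r")
    case True
    then have "farey_pair lam (Suc Q) q a r b" using f by (auto simp: farey_pair_def)
    then show ?thesis by blast
  next
    case False
    then have s: "int (Suc Q) = q + r" using f by (auto simp: farey_pair_def)
    show ?thesis
    proof (cases "of_int (a + b) < lam * of_int (q + r)")
      case True
      then have "farey_pair lam (Suc Q) (q + r) (a + b) r b"
        using f s by (simp add: farey_pair_def algebra_simps)
      then show ?thesis by blast
    next
      case F: False
      have "lam * of_int (q + r) \<noteq> of_int (a + b)"
        using f by (intro irrational_neq_fraction assms) (simp add: farey_pair_def)
      then have "lam * of_int (q + r) < of_int (a + b)" using F by linarith
      then have "farey_pair lam (Suc Q) q a (q + r) (a + b)"
        using f s by (simp add: farey_pair_def algebra_simps)
      then show ?thesis by blast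
    qed
  qed
qed

text \<open>The polygon bounds both coordinates by Q, whereas a Farey pair only bounds the
  denominators explicitly.\<close>

lemma farey_pair_numerators:
  assumes "0 < lam" "lam < 1" "farey_pair lam Q q a r b"
  shows "0 \<le> a" "a < q" "0 < b" "b \<le> r"
proof -
  have f: "1 \<le> q" "1 \<le> r" "q * b = 1 + a * r" "of_int a < lam * of_int q" "lam * of_int r < of_int b"
    using assms(3) by (auto simp: farey_pair_def)
  have "0 < lam * of_int r" using assms f by simp
  then have "0 < real_of_int b" using f by linarith
  then show "0 < b" by simp
  have "lam * of_int q \<le> 1 * of_int q" using assms f by (intro mult_right_mono) auto
  then have "real_of_int a < of_int q" using f by linarith
  then show "a < q" by simp
  show "0 \<le> a"
  proof (rule ccontr)
    assume "\<not> 0 \<le> a"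
    then have "a * r \<le> (-1) * r" using f(2) by (intro mult_right_mono) auto
    moreover have "q * b > 0" using f(1) \<open>0 < b\<close> by simp
    ultimately show False using f(2,3) by linarith
  qed
  show "b \<le> r"
  proof (rule ccontr)
    assume "\<not> b \<le> r"
    then have "q * (r + 1) \<le> q * b" using f(1) by (intro mult_left_mono) auto
    moreover have "a * r \<le> (q - 1) * r" using f(2) \<open>a < q\<close> by (intro mult_right_mono) auto
    ultimately have "q * (r + 1) \<le> 1 + (q - 1) * r" using f(3) by linarith
    then have "q + r \<le> 1" by (simp add: algebra_simps)
    then show False using f by linarith
  qed
qed

text \<open>An integer vector strictly between the two has positive integral coordinates in the
  unimodular basis they form, so its abscissa is at least q + r > Q and it is no edge.\<close>

lemma curv_radius_farey_pair:
  assumes "0 < lam" "lam < 1" "farey_pair lam Q q a r b"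
  shows "curv_radius Q lam = circumradius (of_int q, of_int a) (of_int r, of_int b)"
proof (rule curv_radius_eq_circumradius)
  have f: "1 \<le> q" "q \<le> int Q" "1 \<le> r" "r \<le> int Q" "int Q < q + r" "q * b - a * r = 1"
    "of_int a < lam * of_int q" "lam * of_int r < of_int b"
    using assms(3) by (auto simp: farey_pair_def)
  note n = farey_pair_numerators[OF assms]
  show "1 \<le> Q" using f by linarith
  have "coprime q a"
  proof (rule coprimeI)
    fix c assume "c dvd q" "c dvd a"
    then have "c dvd q * b - a * r" by simp
    then show "is_unit c" using f(6) by simp
  qed
  then show "(real_of_int q, real_of_int a) \<in> jarnik_edges Q"
    using f n by (intro jarnik_edgesI) (auto simp: coprime_iff_gcd_eq_1)
  have "coprime r b"
  proof (rule coprimeI)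
    fix c assume "c dvd r" "c dvd b"
    then have "c dvd q * b - a * r" by simp
    then show "is_unit c" using f(6) by simp
  qed
  then show "(real_of_int r, real_of_int b) \<in> jarnik_edges Q"
    using f n by (intro jarnik_edgesI) (auto simp: coprime_iff_gcd_eq_1)
  show "fst (real_of_int q, real_of_int a) > 0" "fst (real_of_int r, real_of_int b) > 0"
    using f by auto
  show "slope (real_of_int q, real_of_int a) < lam" "lam < slope (real_of_int r, real_of_int b)"
    using f by (auto simp: slope_def field_simps)
  fix g assume "g \<in> jarnik_edges Q"
  then obtain x y where g: "g = (real_of_int x, real_of_int y)" "\<bar>x\<bar> \<le> int Q" by (rule jarnik_edgesE)
  show "\<not> (cross (real_of_int q, real_of_int a) g > 0 \<and> cross g (real_of_int r, real_of_int b) > 0)"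
  proof
    assume "cross (real_of_int q, real_of_int a) g > 0 \<and> cross g (real_of_int r, real_of_int b) > 0"
    then have "real_of_int (q * y - a * x) > 0" "real_of_int (x * b - y * r) > 0"
      by (simp_all add: g(1) cross_def)
    then have m: "q * y - a * x \<ge> 1" "x * b - y * r \<ge> 1" by linarith+
    have "x = x * (q * b - a * r)" using f by simp
    also have "\<dots> = (x * b - y * r) * q + (q * y - a * x) * r" by (simp add: algebra_simps)
    also have "\<dots> \<ge> 1 * q + 1 * r" using m f by (intro add_mono mult_right_mono) auto
    finally show False using g(2) f by linarith
  qed
qed

lemma farey_pair_distance:
  assumes "farey_pair lam Q q a r b"
  shows "lam - 2 / real Q \<le> of_int a / of_int q" "of_int b / of_int r \<le> lam + 2 / real Q"
    "of_int a / of_int q \<le> lam" "lam \<le> of_int b / of_int r"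
proof -
  have f: "1 \<le> q" "q \<le> int Q" "1 \<le> r" "r \<le> int Q" "int Q < q + r" "q * b - a * r = 1"
    "of_int a < lam * of_int q" "lam * of_int r < of_int b"
    using assms by (auto simp: farey_pair_def)
  have Q: "Q > 0" using f by linarith
  show 1: "of_int a / of_int q \<le> lam" and 2: "lam \<le> of_int b / of_int r"
    using f by (auto simp: field_simps)
  \<comment> \<open>This gives q r >= q + r - 1 >= Q, while the two fractions differ by exactly 1 /
    (q r).\<close>
  have "0 \<le> (q - 1) * (r - 1)" using f by simp
  then have "int Q \<le> 2 * (q * r)" using f by (simp add: algebra_simps)
  then have "real_of_int (int Q) \<le> of_int (2 * (q * r))" using of_int_le_iff by blast
  then have qr: "real Q \<le> 2 * (of_int q * of_int r)" by simp
  have "real_of_int (q * b - a * r) = 1" using f(6) by simp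
  then have "of_int b / of_int r - of_int a / of_int q = 1 / (real_of_int q * of_int r)"
    using f by (simp add: field_simps)
  also have "\<dots> \<le> 2 / real Q" using qr Q f by (simp add: field_simps)
  finally have "of_int b / of_int r - real_of_int a / of_int q \<le> 2 / real Q" .
  then show "lam - 2 / real Q \<le> of_int a / of_int q" "of_int b / of_int r \<le> lam + 2 / real Q"
    using 1 2 by linarith+
qed

lemma norm_pair_slope: "x > 0 \<Longrightarrow> norm (x, y) = x * sqrt (1 + (y / x)^2)" for x y :: real
proof -
  assume x: "x > 0"
  have "x * sqrt (1 + (y / x)^2) = sqrt (x^2 * (1 + (y / x)^2))"
    using x by (simp add: real_sqrt_mult)
  also have "x^2 * (1 + (y / x)^2) = x^2 + y^2"
    using x by (simp add: field_simps)
  finally show ?thesis by (simp add: norm_Pair)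
qed

text \<open>Each of the three norms is a denominator times \<open>S\<close> of a slope, and the
  slopes of both edges and of their sum lie within 2 / Q of lam. Monotonicity of \<open>S\<close>
  gives bounds \<open>lo\<close> and \<open>hi\<close> that are independent of the pair. The
  constant is 1 / (2 (3 / pi^2)) = pi^2 / 6.\<close>

lemma scaled_radius_bounds:
  assumes "0 < lam" "lam < 1"
  obtains lo hi where
    "lo \<longlonglongrightarrow> pi^2 / 6 * (1 + lam^2) powr (3/2)" "hi \<longlonglongrightarrow> pi^2 / 6 * (1 + lam^2) powr (3/2)"
    "\<forall>\<^sub>F Q in sequentially. \<forall>q a r b. farey_pair lam Q q a r b \<longrightarrow>
       lo Q * farey_ratio Q q r \<le> scaled_radius Q lam \<and> scaled_radius Q lam \<le> hi Q * farey_ratio Q q r"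
proof -
  define S where "S = (\<lambda>x::real. sqrt (1 + x^2))"
  define H where "H = (\<lambda>x Q. S x ^ 3 / (2 * (scale_factor Q / real Q ^ 3)))"
  have lim: "(\<lambda>Q. H (x Q) Q) \<longlonglongrightarrow> pi^2 / 6 * (1 + lam^2) powr (3/2)" if "x \<longlonglongrightarrow> lam" for x
  proof -
    have "(\<lambda>Q. H (x Q) Q) \<longlonglongrightarrow> S lam ^ 3 / (2 * (3 / pi^2))"
      unfolding H_def S_def by (intro tendsto_intros that scale_factor_asymptotic) auto
    moreover have "S lam ^ 3 = (1 + lam^2) powr (3/2)"
    proof -
      have p: "1 + lam^2 > 0" by (simp add: add_pos_nonneg)
      have "S lam ^ 3 = ((1 + lam^2) powr (1/2)) powr 3"
        using p by (simp add: S_def powr_half_sqrt powr_numeral)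
      then show ?thesis by (simp add: powr_powr)
    qed
    ultimately show ?thesis by (simp add: mult.commute)
  qed
  have z: "(\<lambda>Q. 2 / real Q) \<longlonglongrightarrow> 0" using tendsto_mult[OF tendsto_const lim_1_over_n, of 2] by simp
  \<comment> \<open>The truncation at 0 keeps the argument where \<open>S\<close> is
    increasing.\<close>
  have l1: "(\<lambda>Q. max 0 (lam - 2 / real Q)) \<longlonglongrightarrow> lam"
    using tendsto_max[OF tendsto_const tendsto_diff[OF tendsto_const z], of 0 lam] assms by simp
  have l2: "(\<lambda>Q. lam + 2 / real Q) \<longlonglongrightarrow> lam"
    using tendsto_add[OF tendsto_const z, of lam] by simp
  have S: "S x \<le> S y" "0 \<le> S x" if "0 \<le> x" "x \<le> y" for x y
    using that by (auto simp: S_def intro!: power_mono)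
  show ?thesis
  proof (rule that[OF lim[OF l1] lim[OF l2]])
    show "\<forall>\<^sub>F Q in sequentially. \<forall>q a r b. farey_pair lam Q q a r b \<longrightarrow>
       H (max 0 (lam - 2 / real Q)) Q * farey_ratio Q q r \<le> scaled_radius Q lam \<and>
       scaled_radius Q lam \<le> H (lam + 2 / real Q) Q * farey_ratio Q q r"
      using eventually_scale_factor_pos eventually_gt_at_top[of 0]
    proof (eventually_elim, intro allI impI)
      fix Q q a r b assume elim: "scale_factor Q > 0" "0 < Q" "farey_pair lam Q q a r b"
      define s t m where "s = real_of_int a / of_int q" and "t = real_of_int b / of_int r"
        and "m = real_of_int (a + b) / of_int (q + r)"
      have f: "1 \<le> q" "1 \<le> r" "q * b - a * r = 1" using elim(3) by (auto simp: farey_pair_def)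
      have d: "real_of_int q * of_int b - of_int a * of_int r = 1"
        using f(3) by (metis of_int_1 of_int_diff of_int_mult)
      have "s \<le> m" "m \<le> t"
        using f d unfolding s_def t_def m_def by (simp_all add: divide_simps) (simp_all add: algebra_simps)
      moreover have "0 \<le> s" using farey_pair_numerators[OF assms elim(3)] f by (simp add: s_def)
      moreover note farey_pair_distance[OF elim(3), folded s_def t_def]
      ultimately have st: "max 0 (lam - 2 / real Q) \<le> s" "max 0 (lam - 2 / real Q) \<le> m" "max 0 (lam - 2 / real Q) \<le> t"
        "s \<le> lam + 2 / real Q" "m \<le> lam + 2 / real Q" "t \<le> lam + 2 / real Q"
        "0 \<le> s" "0 \<le> m" "0 \<le> t" by linarith+
      have "cross (real_of_int q, real_of_int a) (real_of_int r, real_of_int b) = 1"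
        using d by (simp add: cross_def)
      then have cr: "curv_radius Q lam = of_int q * S s * (of_int r * S t) * (of_int (q + r) * S m) / 2"
        unfolding curv_radius_farey_pair[OF assms elim(3)] circumradius_def
        using f norm_pair_slope[of "of_int q" "of_int a"] norm_pair_slope[of "of_int r" "of_int b"]
          norm_pair_slope[of "of_int (q + r)" "of_int (a + b)"]
        by (simp add: S_def s_def t_def m_def)
      have eq: "scaled_radius Q lam = (S s * S t * S m) / (2 * (scale_factor Q / real Q ^ 3)) * farey_ratio Q q r"
        unfolding scaled_radius_def cr farey_ratio_def using elim by (simp add: field_simps)
      have ratio: "0 \<le> farey_ratio Q q r" using f by (simp add: farey_ratio_def)
      have "S (max 0 (lam - 2 / real Q)) ^ 3 \<le> S s * S t * S m"
        unfolding power3_eq_cube by (intro mult_mono S mult_nonneg_nonneg) (use st in auto)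
      moreover have "S s * S t * S m \<le> S (lam + 2 / real Q) ^ 3"
        unfolding power3_eq_cube by (intro mult_mono S mult_nonneg_nonneg) (use st assms in auto)
      ultimately show "H (max 0 (lam - 2 / real Q)) Q * farey_ratio Q q r \<le> scaled_radius Q lam \<and>
          scaled_radius Q lam \<le> H (lam + 2 / real Q) Q * farey_ratio Q q r"
        unfolding eq H_def using elim ratio by (intro conjI mult_right_mono divide_right_mono) auto
    qed
  qed
qed

section \<open>Size of the Farey ratio\<close>

lemma farey_pair_reflect: "farey_pair lam Q q a r b \<Longrightarrow> farey_pair (1 - lam) Q r (r - b) q (q - a)"
  by (auto simp: farey_pair_def algebra_simps)

lemma farey_ratio_commute: "farey_ratio Q q r = farey_ratio Q r q"
  by (simp add: farey_ratio_def mult_ac add_ac)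

text \<open>Inserting mediants next to the fraction with the smaller denominator \<open>q\<close> until one of them
  falls below \<open>lam\<close> leads from a pair with denominators \<open>q, s\<close> to one with denominators \<open>q + s, s\<close>.
  The two ratios are at least 1 iff \<open>q\<^sup>2 + q s \<ge> s\<^sup>2\<close> and iff \<open>q\<^sup>2 + q s \<le> s\<^sup>2\<close>, respectively.\<close>
lemma farey_ratio_ge_1_aux:
  assumes irr: "lam \<notin> \<rat>" and f: "farey_pair lam Q q a r b" and qr: "q \<le> r"
  shows "\<exists>Q' q' a' r' b'. r \<le> int Q' \<and> farey_pair lam Q' q' a' r' b' \<and> farey_ratio Q' q' r' \<ge> 1"
proof -
  \<comment> \<open>\<open>P j\<close> says that the j-th mediant (b + j a) / (r + j q) has fallen
    below lam. The clause \<open>j \<ge> 1\<close> makes \<open>P 0\<close> false, so that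
    subtracting 1 from the least j does not truncate.\<close>
  define P where "P = (\<lambda>j::nat. j \<ge> 1 \<and> of_int (b + int j * a) < lam * of_int (r + int j * q))"
  have f': "1 \<le> q" "1 \<le> r" "q * b - a * r = 1" "of_int a < lam * of_int q" "lam * of_int r < of_int b"
    using f by (auto simp: farey_pair_def)
  obtain j where "of_int b - lam * of_int r < real j * (lam * of_int q - of_int a)"
    using reals_Archimedean3[of "lam * of_int q - of_int a"] f' by auto
  moreover from this have "j \<noteq> 0" using f' by (intro notI) simp
  ultimately have "P j" by (simp add: P_def algebra_simps)
  define k where "k = (LEAST j. P j) - 1"
  have "P (LEAST j. P j)" using \<open>P j\<close> by (rule LeastI)
  then have k: "P (Suc k)" by (simp add: k_def P_def)
  have notk: "\<not> P k"
    using not_less_Least[of k P] k by (metis P_def \<open>P (LEAST j. P j)\<close> diff_less k_def less_le_trans zero_less_one)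
  define s c where "s = r + int k * q" and "c = b + int k * a"
  have s: "r \<le> s" "1 \<le> s" "q \<le> s" using f' qr by (simp_all add: s_def add_increasing2)
  have det: "q * c - a * s = 1" using f'(3) by (simp add: s_def c_def algebra_simps)
  have up: "lam * of_int s < of_int c"
  proof (cases "k = 0")
    case False
    then have "\<not> of_int c < lam * of_int s" using notk by (simp add: P_def s_def c_def)
    moreover have "lam * of_int s \<noteq> of_int c" using s by (intro irrational_neq_fraction irr) auto
    ultimately show ?thesis by linarith
  qed (use f' in \<open>simp add: s_def c_def\<close>)
  have low: "of_int (a + c) < lam * of_int (q + s)"
    using k by (simp add: P_def s_def c_def algebra_simps)
  have f1: "farey_pair lam (nat s) q a s c"
    using f' s det up by (simp add: farey_pair_def)
  have f2: "farey_pair lam (nat (q + s)) (q + s) (a + c) s c"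
    using f' s det up low by (simp add: farey_pair_def algebra_simps)
  show ?thesis
  \<comment> \<open>The two pairs arise at the orders s and q + s, where the ratios reduce to q (q +
    s) / s^2 and s (q + 2 s) / (q + s)^2.\<close>
  proof (cases "s\<^sup>2 \<le> q * (q + s)")
    case True
    then have "real_of_int (s * s\<^sup>2) \<le> of_int (s * (q * (q + s)))"
      using s by (intro iffD2[OF of_int_le_iff] mult_left_mono) auto
    then have "farey_ratio (nat s) q s \<ge> 1"
      using s by (simp add: farey_ratio_def power2_eq_square power3_eq_cube mult_ac)
    then show ?thesis using f1 s by (intro exI[of _ "nat s"]) auto
  next
    case False
    then have "(q + s)\<^sup>2 \<le> s * (q + 2 * s)" by (simp add: power2_eq_square algebra_simps)
    then have "real_of_int ((q + s) * (q + s)\<^sup>2) \<le> of_int ((q + s) * (s * (q + 2 * s)))"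
      using s f' by (intro iffD2[OF of_int_le_iff] mult_left_mono) auto
    moreover have "real (nat (q + s)) = of_int (q + s)" using s f' by simp
    ultimately have "farey_ratio (nat (q + s)) (q + s) s \<ge> 1"
      using s f' by (simp add: farey_ratio_def power2_eq_square power3_eq_cube mult_ac add_ac)
    then show ?thesis using f2 s f' by (intro exI[of _ "nat (q + s)"]) auto
  qed
qed

lemma frequently_farey_ratio_ge_1:
  assumes "0 < lam" "lam < 1" "lam \<notin> \<rat>"
  shows "\<exists>\<^sub>F Q in sequentially. \<exists>q a r b. farey_pair lam Q q a r b \<and> farey_ratio Q q r \<ge> 1"
  unfolding frequently_sequentially
proof
  fix N :: nat
  \<comment> \<open>The denominators add up to more than 2 N + 1, so the larger one exceeds N, and
    the order found by \<open>farey_ratio_ge_1_aux\<close> is at least that denominator.\<close>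
  obtain q a r b where f: "farey_pair lam (2 * N + 1) q a r b"
    using farey_pair_exists[OF assms, of "2 * N + 1"] by auto
  show "\<exists>Q\<ge>N. \<exists>q a r b. farey_pair lam Q q a r b \<and> farey_ratio Q q r \<ge> 1"
  proof (cases "q \<le> r")
    case True
    then have "int N \<le> r" using f by (auto simp: farey_pair_def)
    with farey_ratio_ge_1_aux[OF assms(3) f True] show ?thesis by (meson of_nat_le_iff order_trans)
  next
    case False
    then have N: "int N \<le> q" using f by (auto simp: farey_pair_def)
    \<comment> \<open>Replacing lam by 1 - lam exchanges the two neighbours and leaves the ratio
      unchanged, which reduces this case to the first.\<close>
    have "1 - lam \<notin> \<rat>" using assms(3) Rats_diff[of 1 "1 - lam"] by auto
    from farey_ratio_ge_1_aux[OF this farey_pair_reflect[OF f]] False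
    obtain Q' q' a' r' b' where *: "q \<le> int Q'" "farey_pair (1 - lam) Q' q' a' r' b'" "farey_ratio Q' q' r' \<ge> 1"
      by auto
    have "farey_pair lam Q' r' (r' - b') q' (q' - a')" using farey_pair_reflect[OF *(2)] by simp
    moreover have "farey_ratio Q' r' q' \<ge> 1" using *(3) by (simp add: farey_ratio_commute)
    ultimately show ?thesis using N *(1) by (intro exI[of _ Q']) auto
  qed
qed

lemma farey_ratio_le:
  assumes "farey_pair lam Q q a r b"
  shows "farey_ratio Q q r \<le> 2 * of_int (min q r) / real Q" "farey_ratio Q q r \<le> 2" "0 < farey_ratio Q q r"
proof -
  have f: "1 \<le> q" "q \<le> int Q" "1 \<le> r" "r \<le> int Q" using assms by (auto simp: farey_pair_def)
  have f': "real_of_int q \<le> real Q" "real_of_int r \<le> real Q"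
    using f by (metis of_int_le_iff of_int_of_nat_eq)+
  have Q: "real Q > 0" using f by linarith
  have "real_of_int q * of_int r = of_int (min q r) * of_int (max q r)"
    by (simp add: min_def max_def)
  then have "of_int q * of_int r * (of_int q + of_int r) \<le> of_int (min q r) * real Q * (real Q + real Q)"
    using f f' by (auto intro!: mult_mono simp: max_def)
  then have "farey_ratio Q q r \<le> of_int (min q r) * real Q * (real Q + real Q) / real Q ^ 3"
    unfolding farey_ratio_def by (rule divide_right_mono) simp
  also have "\<dots> = 2 * of_int (min q r) / real Q"
    using Q by (simp add: power3_eq_cube field_simps)
  finally show 1: "farey_ratio Q q r \<le> 2 * of_int (min q r) / real Q" .
  also have "\<dots> \<le> 2 * real Q / real Q"
    using f' by (intro divide_right_mono mult_left_mono) (auto simp: min_def)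
  finally show "farey_ratio Q q r \<le> 2" using Q by simp
  show "0 < farey_ratio Q q r" using f Q by (simp add: farey_ratio_def)
qed

text \<open>The larger denominator is at least Q / 2 and the sum is at least Q, so only the smaller
  one needs the hypothesis with \<open>\<delta>\<close>.\<close>

lemma farey_ratio_ge:
  assumes "farey_pair lam Q q a r b" "\<delta> * real Q \<le> of_int q" "\<delta> * real Q \<le> of_int r" "0 \<le> \<delta>"
  shows "\<delta> / 2 \<le> farey_ratio Q q r"
proof -
  have f: "1 \<le> q" "q \<le> int Q" "1 \<le> r" "r \<le> int Q" "int Q < q + r" using assms by (auto simp: farey_pair_def)
  have Q: "real Q > 0" using f by linarith
  have sum: "real Q \<le> real_of_int q + of_int r" using f(5)
    by (metis less_le of_int_add of_int_le_iff of_int_of_nat_eq)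
  have "\<delta> * real Q * (real Q / 2) \<le> of_int (min q r) * of_int (max q r)"
    using assms sum f by (intro mult_mono) (auto simp: min_def max_def)
  also have "\<dots> = of_int q * of_int r" by (simp add: min_def max_def)
  finally have "\<delta> * real Q * (real Q / 2) * real Q \<le> of_int q * of_int r * (of_int q + of_int r)"
    by (rule mult_mono[OF _ sum]) (use f in auto)
  then have "\<delta> * real Q * (real Q / 2) * real Q / real Q ^ 3 \<le> farey_ratio Q q r"
    unfolding farey_ratio_def by (rule divide_right_mono) simp
  then show ?thesis using Q by (simp add: power3_eq_cube)
qed

subsection \<open>Continued fractions\<close>

text \<open>Convergents of [0; b_1, b_2, ...], with 0 / 1 at index 0. Since
  \<open>partial_quotient x n\<close> is b_(n+1), it is the quotient that produces the convergent of
  index n + 1.\<close>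

fun cf_num :: "real \<Rightarrow> nat \<Rightarrow> int" where
  "cf_num x 0 = 0"
| "cf_num x (Suc 0) = 1"
| "cf_num x (Suc (Suc n)) = partial_quotient x (Suc n) * cf_num x (Suc n) + cf_num x n"

fun cf_den :: "real \<Rightarrow> nat \<Rightarrow> int" where
  "cf_den x 0 = 1"
| "cf_den x (Suc 0) = partial_quotient x 0"
| "cf_den x (Suc (Suc n)) = partial_quotient x (Suc n) * cf_den x (Suc n) + cf_den x n"

definition cf_error :: "real \<Rightarrow> nat \<Rightarrow> real" where
  "cf_error x n = of_int (cf_den x n) * x - of_int (cf_num x n)"

lemma cf_det: "cf_den x n * cf_num x (Suc n) - cf_num x n * cf_den x (Suc n) = (-1) ^ n"
  by (induction n) (simp_all add: algebra_simps)

lemma inverse_cf_remainder: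
  "1 / cf_remainder x n = of_int (partial_quotient x n) + cf_remainder x (Suc n)"
  by (simp add: partial_quotient_def frac_def)

locale irrational_unit =
  fixes x :: real
  assumes x_pos: "0 < x" and x_less: "x < 1" and x_irrational: "x \<notin> \<rat>"
begin

lemma cf_remainder_bounds: "0 < cf_remainder x n \<and> cf_remainder x n < 1 \<and> cf_remainder x n \<notin> \<rat>"
proof (induction n)
  case (Suc n)
  have irr: "cf_remainder x (Suc n) \<notin> \<rat>"
  proof
    assume "cf_remainder x (Suc n) \<in> \<rat>"
    then have "1 / cf_remainder x n \<in> \<rat>" unfolding inverse_cf_remainder by (intro Rats_add) auto
    then have "1 / (1 / cf_remainder x n) \<in> \<rat>" by (rule Rats_divide[OF Rats_1])
    then show False using Suc by simp
  qed
  then have "cf_remainder x (Suc n) \<noteq> 0" by (metis Rats_0)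
  then have "0 < cf_remainder x (Suc n)" using frac_ge_0[of "1 / cf_remainder x n"] by simp
  then show ?case using irr by (simp add: frac_lt_1)
qed (use x_pos x_less x_irrational in auto)

lemma partial_quotient_ge_1: "1 \<le> partial_quotient x n"
  using cf_remainder_bounds[of n] by (simp add: partial_quotient_def)


text \<open>Two consecutive indices are treated together because the recursion reaches two steps
  back. The comparison with n makes the denominators unbounded.\<close>

lemma cf_den_bounds: "1 \<le> cf_den x n \<and> cf_den x n \<le> cf_den x (Suc n) \<and> int n \<le> cf_den x n \<and> int (Suc n) \<le> cf_den x (Suc n)"
proof (induction n)
  case 0
  then show ?case using partial_quotient_ge_1[of 0] by simp
next
  case (Suc n)
  have "1 * cf_den x (Suc n) \<le> partial_quotient x (Suc n) * cf_den x (Suc n)"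
    using partial_quotient_ge_1 Suc by (intro mult_right_mono) auto
  then show ?case using Suc unfolding cf_den.simps by linarith
qed

lemma cf_den_ge: "partial_quotient x n * cf_den x n \<le> cf_den x (Suc n)"
  using cf_den_bounds by (cases n) (simp_all, smt (verit))

lemma cf_den_le: "cf_den x (Suc n) \<le> (partial_quotient x n + 1) * cf_den x n"
  using cf_den_bounds[of "n - 1"] by (cases n) (simp_all add: algebra_simps)

text \<open>Errors obey the recursion of the convergents, and 1 / y = b + z relates consecutive
  remainders. So errors alternate in sign, with remainders as the ratios of their sizes.\<close>

lemma cf_error_Suc: "cf_error x (Suc n) = - cf_remainder x (Suc n) * cf_error x n"
proof (induction n)
  case 0
  then show ?case using inverse_cf_remainder[of x 0] x_pos by (simp add: cf_error_def field_simps)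
next
  case (Suc n)
  let ?y = "cf_remainder x (Suc n)" let ?z = "cf_remainder x (Suc (Suc n))"
  let ?b = "of_int (partial_quotient x (Suc n)) :: real"
  have y: "?y > 0" using cf_remainder_bounds by blast
  have eq: "1 = ?y * (?b + ?z)" using inverse_cf_remainder[of x "Suc n"] y by (simp add: field_simps)
  have "cf_error x (Suc (Suc n)) = ?b * cf_error x (Suc n) + 1 * cf_error x n"
    by (simp add: cf_error_def algebra_simps)
  also have "\<dots> = - ?z * cf_error x (Suc n)"
    unfolding eq Suc.IH by (simp add: algebra_simps)
  finally show ?case .
qed

lemma cf_error_mult: "cf_error x n * (of_int (cf_den x (Suc n)) + of_int (cf_den x n) * cf_remainder x (Suc n)) = (-1) ^ n"
proof -
  have "of_int (cf_den x (Suc n)) * cf_error x n - of_int (cf_den x n) * cf_error x (Suc n)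
      = real_of_int (cf_den x n * cf_num x (Suc n) - cf_num x n * cf_den x (Suc n))"
    by (simp add: cf_error_def algebra_simps)
  then show ?thesis unfolding cf_det cf_error_Suc by (simp add: algebra_simps)
qed

text \<open>By \<open>cf_error_mult\<close> the error is the reciprocal of a number between the next
  denominator and twice that denominator.\<close>

lemma abs_cf_error_bounds:
  "1 / (2 * of_int (cf_den x (Suc n))) \<le> \<bar>cf_error x n\<bar>" "\<bar>cf_error x n\<bar> \<le> 1 / of_int (cf_den x (Suc n))"
proof -
  let ?q = "real_of_int (cf_den x n)" and ?r = "real_of_int (cf_den x (Suc n))"
  define y where "y = cf_remainder x (Suc n)"
  have q: "1 \<le> cf_den x n" "cf_den x n \<le> cf_den x (Suc n)" using cf_den_bounds by auto
  then have q: "1 \<le> ?q" "?q \<le> ?r" by simp_all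
  have y: "0 < y" "y < 1" unfolding y_def using cf_remainder_bounds[of "Suc n"] by blast+
  have pos: "0 \<le> ?q * y" using q y by simp
  have "\<bar>cf_error x n\<bar> * \<bar>?r + ?q * y\<bar> = 1"
    using cf_error_mult[of n, folded y_def] by (simp add: abs_mult[symmetric])
  then have eq: "\<bar>cf_error x n\<bar> = 1 / (?r + ?q * y)"
    using pos q by (simp add: eq_divide_eq)
  have "?q * y \<le> ?q * 1" using q y by (intro mult_left_mono) auto
  then have "?q * y \<le> ?r" using q by linarith
  then show "1 / (2 * ?r) \<le> \<bar>cf_error x n\<bar>" "\<bar>cf_error x n\<bar> \<le> 1 / ?r"
    unfolding eq using pos q by (auto intro!: frac_le)
qed

text \<open>Let u, v be the coordinates of (q, a) in the unimodular basis of two consecutive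
  convergents. The bounds on q force u and v to have opposite signs unless v = 0; as the two errors
  also have opposite signs, their contributions cannot cancel.\<close>

lemma best_approximation:
  assumes q: "0 < q" "q < cf_den x (Suc n)"
  shows "\<bar>cf_error x n\<bar> \<le> \<bar>of_int q * x - of_int a\<bar>"
proof -
  define u v where "u = (-1) ^ n * (q * cf_num x (Suc n) - a * cf_den x (Suc n))"
    and "v = (-1) ^ n * (a * cf_den x n - q * cf_num x n)"
  have sq: "(-1::int) ^ n * (-1) ^ n = 1" by (simp flip: power_add)
  have d: "cf_den x n * cf_num x (Suc n) - cf_num x n * cf_den x (Suc n) = (-1) ^ n" by (rule cf_det)
  have "u * cf_den x n + v * cf_den x (Suc n)
      = q * ((-1) ^ n * (cf_den x n * cf_num x (Suc n) - cf_num x n * cf_den x (Suc n)))"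
    unfolding u_def v_def by (simp only: algebra_simps)
  then have qe: "q = u * cf_den x n + v * cf_den x (Suc n)" unfolding d sq by simp
  have "u * cf_num x n + v * cf_num x (Suc n)
      = a * ((-1) ^ n * (cf_den x n * cf_num x (Suc n) - cf_num x n * cf_den x (Suc n)))"
    unfolding u_def v_def by (simp only: algebra_simps)
  then have ae: "a = u * cf_num x n + v * cf_num x (Suc n)" unfolding d sq by simp
  have "of_int q * x - of_int a = of_int u * cf_error x n + of_int v * cf_error x (Suc n)"
    unfolding cf_error_def by (subst qe, subst ae) (simp add: algebra_simps)
  then have eq: "of_int q * x - of_int a = (of_int u - of_int v * cf_remainder x (Suc n)) * cf_error x n"
    unfolding cf_error_Suc by (simp add: algebra_simps)
  have den: "1 \<le> cf_den x n" "1 \<le> cf_den x (Suc n)" using cf_den_bounds by blast+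
  have y: "0 < cf_remainder x (Suc n)" using cf_remainder_bounds by blast
  have "1 \<le> \<bar>of_int u - of_int v * cf_remainder x (Suc n)\<bar>"
  proof (cases "v = 0" "v > 0" rule: bool.exhaust[case_product bool.exhaust])
    case True_True
    then show ?thesis by simp
  next
    case True_False
    then have "u \<noteq> 0" using qe q by auto
    then have "1 \<le> \<bar>u\<bar>" by simp
    then have "1 \<le> \<bar>real_of_int u\<bar>" by (metis of_int_1_le_iff of_int_abs)
    then show ?thesis using True_False by simp
  next
    case False_True
    then have "1 * cf_den x (Suc n) \<le> v * cf_den x (Suc n)" using den by (intro mult_right_mono) auto
    then have "u * cf_den x n < 0" using qe q by linarith
    then have "u < 0" using den by (simp add: mult_less_0_iff)
    then have "real_of_int u \<le> - 1" by linarith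
    moreover have "0 \<le> of_int v * cf_remainder x (Suc n)" using False_True y by simp
    ultimately show ?thesis by linarith
  next
    case False_False
    then have "v * cf_den x (Suc n) < 0" using den by (simp add: mult_less_0_iff)
    then have "u * cf_den x n > 0" using qe q by linarith
    then have "u > 0" using den by (simp add: zero_less_mult_iff)
    then have "1 \<le> real_of_int u" by linarith
    moreover have "of_int v * cf_remainder x (Suc n) \<le> 0" using False_False y by (simp add: mult_nonpos_nonneg)
    ultimately show ?thesis by linarith
  qed
  then have "1 * \<bar>cf_error x n\<bar> \<le> \<bar>of_int u - of_int v * cf_remainder x (Suc n)\<bar> * \<bar>cf_error x n\<bar>"
    by (intro mult_right_mono) auto
  then show ?thesis unfolding eq abs_mult by simp
qed

text \<open>Choose n so that q lies between the denominators of index n and n + 1. The approximation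
  by q is no better than that of the n-th convergent, and the next denominator is at most (B + 1)
  q.\<close>

lemma diophantine_of_bounded_quotients:
  assumes B: "\<And>n. partial_quotient x n \<le> B" and q: "1 \<le> q"
  shows "1 / (2 * (of_int B + 1)) \<le> of_int q * \<bar>of_int q * x - of_int a\<bar>"
proof -
  define m where "m = (LEAST m. q < cf_den x m)"
  have "q < cf_den x (Suc (nat q))" using cf_den_bounds[of "Suc (nat q)"] q by linarith
  then have m: "q < cf_den x m" unfolding m_def by (rule LeastI)
  then have "m \<noteq> 0" using q by (intro notI) simp
  then obtain n where n: "m = Suc n" by (cases m) auto
  have "\<not> q < cf_den x n" using not_less_Least[of n "\<lambda>m. q < cf_den x m"] n by (simp add: m_def)
  then have "(partial_quotient x n + 1) * cf_den x n \<le> (B + 1) * q"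
    using B[of n] partial_quotient_ge_1[of n] cf_den_bounds[of n] by (intro mult_mono) auto
  then have "cf_den x (Suc n) \<le> (B + 1) * q" using cf_den_le[of n] by linarith
  then have "real_of_int (cf_den x (Suc n)) \<le> of_int ((B + 1) * q)" by (rule of_int_le_iff[THEN iffD2])
  then have den: "real_of_int (cf_den x (Suc n)) \<le> (of_int B + 1) * of_int q" by simp
  have "1 \<le> cf_den x (Suc n)" using cf_den_bounds by blast
  then have den1: "1 \<le> real_of_int (cf_den x (Suc n))" by simp
  have B1: "of_int B + 1 > (0::real)" using B[of 0] partial_quotient_ge_1[of 0] by linarith
  have "1 / (2 * ((of_int B + 1) * of_int q)) \<le> 1 / (2 * real_of_int (cf_den x (Suc n)))"
    using den den1 B1 q by (intro divide_left_mono) auto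
  also have "\<dots> \<le> \<bar>cf_error x n\<bar>" by (rule abs_cf_error_bounds)
  also have "\<dots> \<le> \<bar>of_int q * x - of_int a\<bar>" using best_approximation[of q n a] m n q by simp
  finally have "of_int q * (1 / (2 * ((of_int B + 1) * of_int q))) \<le> of_int q * \<bar>of_int q * x - of_int a\<bar>"
    using q by (intro mult_left_mono) auto
  then show ?thesis using q by simp
qed

text \<open>The errors \<open>\<alpha>\<close>, \<open>\<beta>\<close> of the two neighbours satisfy
  \<open>\<alpha>\<close> r + \<open>\<beta>\<close> q = 1, while q \<open>\<alpha>\<close> and r
  \<open>\<beta>\<close> are at least d. Hence q >= d r and r >= d q, and Q < q + r yields the
  constant d / (1 + d).\<close>

lemma farey_pair_balanced:
  assumes B: "\<And>n. partial_quotient x n \<le> B"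
  obtains \<delta> where "0 < \<delta>" "\<And>Q q a r b. farey_pair x Q q a r b \<Longrightarrow> \<delta> * real Q \<le> of_int (min q r)"
proof -
  define d where "d = 1 / (2 * (real_of_int B + 1))"
  have d: "d > 0" using B[of 0] partial_quotient_ge_1[of 0] by (simp add: d_def)
  have "d / (1 + d) * real Q \<le> of_int (min q r)" if f: "farey_pair x Q q a r b" for Q q a r b
  proof -
    have f: "1 \<le> q" "1 \<le> r" "int Q < q + r" "q * b - a * r = 1"
      "of_int a < x * of_int q" "x * of_int r < of_int b"
      using f by (auto simp: farey_pair_def)
    define \<alpha> \<beta> where "\<alpha> = x * of_int q - of_int a" and "\<beta> = of_int b - x * of_int r"
    have pos: "\<alpha> > 0" "\<beta> > 0" using f by (simp_all add: \<alpha>_def \<beta>_def)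
    have "\<alpha> * of_int r + \<beta> * of_int q = real_of_int (q * b - a * r)"
      by (simp add: \<alpha>_def \<beta>_def algebra_simps)
    then have one: "\<alpha> * of_int r + \<beta> * of_int q = 1" by (simp add: f(4))
    have dq: "d \<le> of_int q * \<alpha>"
      using diophantine_of_bounded_quotients[OF B f(1), of a] pos(1) by (simp add: d_def \<alpha>_def mult.commute)
    have dr: "d \<le> of_int r * \<beta>"
      using diophantine_of_bounded_quotients[OF B f(2), of b] pos(2)
      by (simp add: d_def \<beta>_def mult.commute abs_minus_commute[of "_ * x"])
    have "d * of_int r \<le> of_int q * \<alpha> * of_int r" using dq f by (intro mult_right_mono) auto
    also have "\<dots> = of_int q * (\<alpha> * of_int r)" by simp
    also have "\<dots> \<le> of_int q * 1" using one pos f by (intro mult_left_mono) (auto, smt (verit) mult_nonneg_nonneg of_int_0_le_iff)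
    finally have qr: "d * of_int r \<le> of_int q" by simp
    have "d * of_int q \<le> of_int r * \<beta> * of_int q" using dr f by (intro mult_right_mono) auto
    also have "\<dots> = of_int r * (\<beta> * of_int q)" by simp
    also have "\<dots> \<le> of_int r * 1" using one pos f by (intro mult_left_mono) (auto, smt (verit) mult_nonneg_nonneg of_int_0_le_iff)
    finally have rq: "d * of_int q \<le> of_int r" by simp
    have Q: "real Q \<le> of_int q + of_int r" using f(3) by linarith
    then have "d * real Q \<le> d * (of_int q + of_int r)" using d by (intro mult_left_mono) auto
    then have "d * real Q \<le> (1 + d) * of_int q" "d * real Q \<le> (1 + d) * of_int r"
      using qr rq by (simp_all add: algebra_simps)
    then have "d * real Q \<le> (1 + d) * of_int (min q r)" by (simp add: min_def)
    then show ?thesis using d by (simp add: field_simps)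
  qed
  then show ?thesis using d by (intro that[of "d / (1 + d)"]) auto
qed

text \<open>Write (s, c) = u (q, a) + v (r, b). Coordinates of opposite signs make the error at
  least \<open>\<alpha>\<close> + \<open>\<beta>\<close> >= 1 / Q; equal signs contradict 0 < s < q
  + r. So one coordinate is 0, and s is a positive multiple of q or r.\<close>

lemma farey_pair_min_le:
  assumes f: "farey_pair x Q q a r b" and s: "1 \<le> s" "s \<le> int Q"
    and close: "\<bar>of_int s * x - of_int c\<bar> < 1 / real Q"
  shows "min q r \<le> s"
proof (rule ccontr)
  assume neg: "\<not> min q r \<le> s"
  have f: "1 \<le> q" "1 \<le> r" "q \<le> int Q" "r \<le> int Q" "int Q < q + r" "q * b - a * r = 1"
    "of_int a < x * of_int q" "x * of_int r < of_int b"
    using f by (auto simp: farey_pair_def)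
  define \<alpha> \<beta> where "\<alpha> = x * of_int q - of_int a" and "\<beta> = of_int b - x * of_int r"
  define u v where "u = s * b - c * r" and "v = q * c - a * s"
  have pos: "\<alpha> > 0" "\<beta> > 0" using f by (simp_all add: \<alpha>_def \<beta>_def)
  have "\<alpha> * of_int r + \<beta> * of_int q = real_of_int (q * b - a * r)"
    by (simp add: \<alpha>_def \<beta>_def algebra_simps)
  then have "1 = \<alpha> * of_int r + \<beta> * of_int q" by (simp add: f)
  also have "\<dots> \<le> \<alpha> * real Q + \<beta> * real Q"
  proof (intro add_mono mult_left_mono)
    show "real_of_int r \<le> real Q" "real_of_int q \<le> real Q" using f by linarith+
  qed (use pos in auto)
  finally have ab: "1 / real Q \<le> \<alpha> + \<beta>" using s by (simp add: field_simps)
  have "u * q + v * r = s * (q * b - a * r)" "u * a + v * b = c * (q * b - a * r)"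
    by (simp_all add: u_def v_def algebra_simps)
  then have sc: "s = u * q + v * r" "c = u * a + v * b" unfolding f(6) by simp_all
  have err: "of_int s * x - of_int c = of_int u * \<alpha> - of_int v * \<beta>"
    unfolding \<alpha>_def \<beta>_def by (subst sc(1), subst sc(2)) (simp add: algebra_simps)
  have big: "1 / real Q \<le> \<bar>of_int u * \<alpha> - of_int v * \<beta>\<bar>" if "u \<ge> 1 \<and> v \<le> - 1 \<or> u \<le> - 1 \<and> v \<ge> 1"
    using that
  proof
    assume uv: "u \<ge> 1 \<and> v \<le> - 1"
    then have "1 * \<alpha> \<le> of_int u * \<alpha>" "of_int v * \<beta> \<le> (-1) * \<beta>"
      using pos by (intro mult_right_mono; simp; linarith)+
    then show ?thesis using ab by linarith
  next
    assume uv: "u \<le> - 1 \<and> v \<ge> 1"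
    then have "of_int u * \<alpha> \<le> (-1) * \<alpha>" "1 * \<beta> \<le> of_int v * \<beta>"
      using pos by (intro mult_right_mono; simp; linarith)+
    then show ?thesis using ab by linarith
  qed
  have "u \<noteq> 0"
  proof
    assume "u = 0"
    then have "s = v * r" using sc by simp
    moreover from this have "v \<ge> 1" using s f by (simp add: zero_less_mult_iff flip: zero_less_iff_neq_zero)
        (smt (verit) mult_nonpos_nonneg)
    ultimately have "1 * r \<le> s" using f by (metis mult_right_mono order_trans zero_le_one)
    then show False using neg by simp
  qed
  moreover have "v \<noteq> 0"
  proof
    assume "v = 0"
    then have su: "s = u * q" using sc by simp
    then have "u \<ge> 1" using s f by (smt (verit) mult_nonpos_nonneg)
    then have "1 * q \<le> u * q" using f by (intro mult_right_mono) auto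
    then show False using neg su by simp
  qed
  moreover have "\<not> (u \<ge> 1 \<and> v \<ge> 1)"
  proof
    assume "u \<ge> 1 \<and> v \<ge> 1"
    then have "1 * q + 1 * r \<le> u * q + v * r" using f by (intro add_mono mult_right_mono) auto
    then show False using sc s f by linarith
  qed
  moreover have "\<not> (u \<le> - 1 \<and> v \<le> - 1)"
  proof
    assume "u \<le> - 1 \<and> v \<le> - 1"
    then have "u * q + v * r \<le> (-1) * q + (-1) * r" using f by (intro add_mono mult_right_mono) auto
    then show False using sc s f by linarith
  qed
  ultimately have "u \<ge> 1 \<and> v \<le> - 1 \<or> u \<le> - 1 \<and> v \<ge> 1" by linarith
  from big[OF this] show False using close err by linarith
qed

text \<open>A large quotient p means that a convergent of denominator s is still very good at orders
  near p s. By \<open>farey_pair_min_le\<close> the smaller denominator is then at most s, far below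
  p s.\<close>

lemma bounded_quotients_of_balanced:
  assumes "0 < \<delta>" and bal: "\<And>Q q a r b. N \<le> Q \<Longrightarrow> farey_pair x Q q a r b \<Longrightarrow> \<delta> * real Q \<le> of_int (min q r)"
  shows "\<exists>B. \<forall>n. partial_quotient x n \<le> B"
proof (intro exI allI)
  fix n
  \<comment> \<open>\<open>p * s\<close> is at most the next denominator, so stopping just below it
    keeps the error of the convergent under 1 / Q. In the bound, \<open>int N + 2\<close> secures N
    <= Q and s <= Q; the other term comes from \<open>\<delta>\<close> (p - 1) s <= s.\<close>
  define p s Q where "p = partial_quotient x n" and "s = cf_den x n" and "Q = nat (p * s - 1)"
  show "p \<le> max (int N + 2) (\<lceil>1 + 1 / \<delta>\<rceil>)"
  proof (rule ccontr)
    assume "\<not> ?thesis"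
    then have p: "p > int N + 2" "p > \<lceil>1 + 1 / \<delta>\<rceil>" by auto
    have s: "1 \<le> s" using cf_den_bounds by (simp add: s_def)
    have ps: "p \<le> p * s" "2 * s \<le> p * s"
      using mult_left_mono[of 1 s p] mult_right_mono[of 2 p s] p s by simp_all
    then have Q: "int Q = p * s - 1" using p by (simp add: Q_def)
    then have Q: "int Q = p * s - 1" "N \<le> Q" "1 \<le> Q" "s \<le> int Q" using ps p s by linarith+
    obtain q a r b where f: "farey_pair x Q q a r b"
      using farey_pair_exists[OF x_pos x_less x_irrational Q(3)] by blast
    have "\<bar>of_int s * x - of_int (cf_num x n)\<bar> \<le> 1 / of_int (cf_den x (Suc n))"
      using abs_cf_error_bounds(2)[of n] by (simp add: cf_error_def s_def)
    also have "\<dots> < 1 / real Q"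
    proof (rule divide_strict_left_mono)
      have "int Q < cf_den x (Suc n)" using cf_den_ge[of n] Q(1) by (simp add: p_def s_def)
      then show "real Q < of_int (cf_den x (Suc n))" by linarith
      then show "0 < of_int (cf_den x (Suc n)) * real Q" using Q(3) by (intro mult_pos_pos) linarith+
    qed simp
    finally have "min q r \<le> s" by (rule farey_pair_min_le[OF f s Q(4)])
    then have "real_of_int (min q r) \<le> of_int s" by (rule of_int_le_iff[THEN iffD2])
    then have "\<delta> * real Q \<le> of_int s" using bal[OF Q(2) f] by linarith
    moreover have "(of_int p - 1) * of_int s \<le> real Q"
    proof -
      have "(p - 1) * s \<le> int Q" using Q(1) s by (simp add: algebra_simps)
      then have "real_of_int ((p - 1) * s) \<le> of_int (int Q)" by (rule of_int_le_iff[THEN iffD2])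
      then show ?thesis by simp
    qed
    then have "\<delta> * ((of_int p - 1) * of_int s) \<le> \<delta> * real Q" using assms(1) by (intro mult_left_mono) auto
    ultimately have "(\<delta> * (of_int p - 1)) * of_int s \<le> 1 * of_int s" by simp
    then have "\<delta> * (of_int p - 1) \<le> 1" using s by (simp add: mult_le_cancel_right)
    then have "of_int p \<le> 1 + 1 / \<delta>" using assms(1) by (simp add: field_simps)
    then show False using p(2) by linarith
  qed
qed

end

subsection \<open>Badly approximable numbers form a null set\<close>

lemma cf_remainder_shift: "cf_remainder (cf_remainder x (Suc 0)) n = cf_remainder x (Suc n)"
  by (induction n) auto

lemma partial_quotient_shift: "partial_quotient (cf_remainder x (Suc 0)) n = partial_quotient x (Suc n)"
  unfolding partial_quotient_def cf_remainder_shift ..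

definition bounded_quotients :: "nat \<Rightarrow> real set" where
  "bounded_quotients B = {x. 0 < x \<and> x < 1 \<and> x \<notin> \<rat> \<and> (\<forall>n. partial_quotient x n \<le> int B)}"

lemma bounded_quotients_measurable: "bounded_quotients B \<in> sets borel"
proof -
  have [measurable]: "(\<lambda>x. cf_remainder x n) \<in> borel_measurable borel" for n
    by (induction n) (simp_all add: frac_def)
  have "{x. \<forall>n. 1 / cf_remainder x n < real B + 1} \<in> sets borel"
    by measurable
  moreover have "(\<rat> :: real set) \<in> sets borel"
    by (rule sets.countable[OF _ countable_rat]) simp
  moreover have "bounded_quotients B = ({0<..<1} - \<rat>) \<inter> {x. \<forall>n. 1 / cf_remainder x n < real B + 1}"
    unfolding bounded_quotients_def partial_quotient_def floor_le_iff by auto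
  ultimately show ?thesis by auto
qed

text \<open>The image y of x under the Gauss map has the quotients of x shifted by one, so it stays
  in the set; x is recovered by the inverse branch of its first quotient.\<close>

lemma bounded_quotients_subset:
  assumes "x \<in> bounded_quotients B"
  shows "\<exists>b\<in>{1..B}. x \<in> (\<lambda>y. 1 / (real b + y)) ` bounded_quotients B"
proof -
  have x: "0 < x" "x < 1" "x \<notin> \<rat>" "\<And>n. partial_quotient x n \<le> int B"
    using assms by (auto simp: bounded_quotients_def)
  define y b where "y = cf_remainder x (Suc 0)" and "b = nat (partial_quotient x 0)"
  have pq: "1 \<le> partial_quotient x 0" using x by (simp add: partial_quotient_def)
  then have b: "b \<in> {1..B}" using x(4)[of 0] by (auto simp: b_def)
  have inv: "1 / x = real b + y"
  proof -
    have "real b = of_int (partial_quotient x 0)" using pq by (simp add: b_def)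
    then show ?thesis by (simp add: y_def partial_quotient_def frac_def)
  qed
  then have xy: "x = 1 / (real b + y)" using x(1) by (metis divide_divide_eq_right mult_1 div_by_1)
  have "y \<notin> \<rat>"
  proof
    assume "y \<in> \<rat>"
    then have "1 / (real b + y) \<in> \<rat>" by (intro Rats_divide Rats_add) auto
    then show False using xy x(3) by simp
  qed
  moreover have "0 \<le> y" "y < 1" by (simp_all add: y_def frac_lt_1)
  moreover have "0 \<noteq> y" using \<open>y \<notin> \<rat>\<close> by (metis Rats_0)
  moreover have "partial_quotient y n \<le> int B" for n
    using x(4) by (simp add: y_def partial_quotient_shift del: cf_remainder.simps)
  ultimately have "y \<in> bounded_quotients B" by (simp add: bounded_quotients_def)
  then show ?thesis using b xy by blast
qed

text \<open>Integrating the invariant density \<open>1 / (1 + x)\<close> of the Gauss map over the set and over its images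
  under the inverse branches \<open>y \<mapsto> 1 / (b + y)\<close>, \<open>b \<le> B\<close>, leaves no room for positive measure: the
  branch \<open>B + 1\<close> would have to be accounted for as well.\<close>
lemma bounded_quotients_negligible: "negligible (bounded_quotients B)"
proof -
  define E where "E = bounded_quotients B"
  define h where "h = (\<lambda>x::real. 1 / (1 + x))"
  define g where "g = (\<lambda>(b::nat) y::real. 1 / (real b + y))"
  \<comment> \<open>The same expression as \<open>g\<close>, in a second role: \<open>g\<close> is
    the inverse branch, while \<open>k\<close> serves for the partial fractions of the transported
    density.\<close>
  define k where "k = (\<lambda>(b::nat) y::real. 1 / (real b + y))"
  have E01: "0 < x \<and> x < 1" if "x \<in> E" for x using that by (simp add: E_def bounded_quotients_def)
  have E: "E \<in> sets lebesgue" using bounded_quotients_measurable[of B] by (simp add: E_def)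
  have "bounded E" using E01 by (intro bounded_subset[OF bounded_closed_interval[of 0 1]]) (auto simp: less_imp_le)
  then have Em: "E \<in> lmeasurable" using E by (intro bounded_set_imp_lmeasurable)
  have one: "(\<lambda>_. 1::real) integrable_on E" using Em by (simp add: lmeasurable_iff_integrable_on)
  have k_int: "(\<lambda>y. k b y) absolutely_integrable_on E" if "b \<ge> 1" for b
  proof (rule measurable_bounded_by_integrable_imp_absolutely_integrable[OF _ E one])
    show "(\<lambda>y. k b y) \<in> borel_measurable (lebesgue_on E)"
      using that E01 unfolding k_def
      by (intro continuous_imp_measurable_on_sets_lebesgue continuous_intros E) (auto, fastforce)
    fix x assume "x \<in> E"
    then show "norm (k b x) \<le> 1" using E01[of x] that by (simp add: k_def)
  qed
  have k_int': "(\<lambda>y. k b y) integrable_on E" if "b \<ge> 1" for b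
    using k_int[OF that] by (rule set_lebesgue_integral_eq_integral(1))
  have change: "h absolutely_integrable_on (g b ` E) \<and> integral (g b ` E) h = integral E (\<lambda>y. k b y - k (Suc b) y)"
    if b: "b \<ge> 1" for b
  proof -
    \<comment> \<open>Pulled back along the branch, the density becomes 1 / ((b + y) (b + 1 + y)),
      which telescopes over b.\<close>
    have eq: "\<bar>- (1 / (real b + y)\<^sup>2)\<bar> * h (g b y) = k b y - k (Suc b) y" if "y \<in> E" for y
      using E01[OF that] b by (simp add: h_def g_def k_def divide_simps power2_eq_square)
    have "(\<lambda>y. k b y - k (Suc b) y) absolutely_integrable_on E"
      using k_int b by (intro set_integral_diff) auto
    then have "(\<lambda>y. \<bar>- (1 / (real b + y)\<^sup>2)\<bar> * h (g b y)) absolutely_integrable_on E \<and>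
        integral E (\<lambda>y. \<bar>- (1 / (real b + y)\<^sup>2)\<bar> * h (g b y)) = integral E (\<lambda>y. k b y - k (Suc b) y)"
      using eq set_integrable_cong[OF refl refl, of E "\<lambda>y. \<bar>- (1 / (real b + y)\<^sup>2)\<bar> * h (g b y)"]
        integral_cong[of E "\<lambda>y. \<bar>- (1 / (real b + y)\<^sup>2)\<bar> * h (g b y)"] by auto
    moreover have "(g b has_field_derivative - (1 / (real b + y)\<^sup>2)) (at y within E)" if "y \<in> E" for y
      unfolding g_def using E01[OF that] b
      by (auto intro!: derivative_eq_intros simp: power2_eq_square)
    moreover have "inj_on (g b) E" using E01 b by (auto simp: inj_on_def g_def field_simps)
    ultimately show ?thesis
      using has_absolute_integral_change_of_variables_1'[OF E, of "g b" "\<lambda>y. - (1 / (real b + y)\<^sup>2)" h] by blast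
  qed
  let ?I = "\<lambda>S x. if x \<in> S then h x else 0"
  have hE: "h integrable_on E" using k_int'[of 1] by (simp add: h_def k_def)
  have "integral E h = integral UNIV (?I E)" by (simp add: integral_restrict_UNIV)
  also have "\<dots> \<le> integral UNIV (\<lambda>x. \<Sum>b=1..B. ?I (g b ` E) x)"
  proof (rule integral_le)
    show "?I E integrable_on UNIV" using hE by (simp add: integrable_restrict_UNIV)
    show "(\<lambda>x. \<Sum>b=1..B. ?I (g b ` E) x) integrable_on UNIV"
      using change by (intro integrable_sum) (auto simp: integrable_restrict_UNIV intro: set_lebesgue_integral_eq_integral(1))
    fix x
    have nonneg: "0 \<le> ?I (g b ` E) x" for b
      using E01 by (auto simp: h_def g_def) (smt (verit) divide_nonneg_nonneg of_nat_0_le_iff)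
    show "?I E x \<le> (\<Sum>b=1..B. ?I (g b ` E) x)"
    proof (cases "x \<in> E")
      case True
      then obtain b where "b \<in> {1..B}" "x \<in> g b ` E"
        using bounded_quotients_subset[of x B] unfolding E_def g_def by blast
      then show ?thesis
        using True member_le_sum[of b "{1..B}" "\<lambda>b. ?I (g b ` E) x"] nonneg by simp
    next
      case False
      then show ?thesis using nonneg by (simp only: if_False) (rule sum_nonneg)
    qed
  qed
  also have "\<dots> = (\<Sum>b=1..B. integral UNIV (?I (g b ` E)))"
    using change by (intro integral_sum) (auto simp: integrable_restrict_UNIV intro: set_lebesgue_integral_eq_integral(1))
  also have "\<dots> = (\<Sum>b=1..B. integral E (\<lambda>y. k b y - k (Suc b) y))"
    using change by (intro sum.cong) (auto simp: integral_restrict_UNIV)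
  also have "\<dots> = (\<Sum>b=1..B. integral E (k b) - integral E (k (Suc b)))"
    using k_int' by (intro sum.cong integral_diff) auto
  also have "\<dots> = integral E (k 1) - integral E (k (Suc B))"
    by (induction B) auto
  also have "k 1 = h" by (auto simp: k_def h_def)
  \<comment> \<open>Covering by B branches gives I(h) <= I(h) - I(\<open>k (Suc B)\<close>), where I
    is the integral over E; yet \<open>k (Suc B)\<close> is at least 1 / (B + 2) on E.\<close>
  finally have le: "integral E (k (Suc B)) \<le> 0" by simp
  have "measure lebesgue E * (1 / (real B + 2)) = integral E (\<lambda>_. 1 / (real B + 2))"
    using lmeasure_integral[OF Em] integral_mult_left[of E "\<lambda>_. 1::real" "1 / (real B + 2)"] by simp
  also have "\<dots> \<le> integral E (k (Suc B))"
  proof (rule integral_le)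
    show "(\<lambda>_. 1 / (real B + 2)) integrable_on E" using integrable_on_mult_left[OF one, of "1 / (real B + 2)"] by simp
    show "1 / (real B + 2) \<le> k (Suc B) y" if "y \<in> E" for y
      using E01[OF that] by (auto simp: k_def intro!: divide_left_mono)
  qed (use k_int' in auto)
  finally have "measure lebesgue E * (1 / (real B + 2)) \<le> 0" using le by linarith
  then have "measure lebesgue E \<le> 0" by (simp add: mult_le_0_iff divide_le_0_iff)
  then have "measure lebesgue E = 0" by (simp add: order_antisym)
  then show ?thesis using Em unfolding E_def by (simp add: negligible_iff_measure)
qed

lemma badly_approximable_null: "{x. badly_approximable x} \<in> null_sets lebesgue"
proof -
  have "{x. badly_approximable x} \<subseteq> (\<Union>B. bounded_quotients B)"
  proof
    fix x assume "x \<in> {x. badly_approximable x}"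
    then obtain B where x: "0 < x" "x < 1" "x \<notin> \<rat>" "\<And>n. partial_quotient x n \<le> B"
      by (auto simp: badly_approximable_def)
    have "partial_quotient x n \<le> int (nat B)" for n using x(4)[of n] by simp
    then show "x \<in> (\<Union>B. bounded_quotients B)" using x unfolding bounded_quotients_def by blast
  qed
  moreover have "negligible (\<Union>B. bounded_quotients B)"
    by (intro negligible_countable_Union) (auto intro: bounded_quotients_negligible)
  ultimately show ?thesis
    using negligible_subset negligible_iff_null_sets by blast
qed

subsection \<open>Limits superior and inferior\<close>

lemma limit_const_pos: "0 < pi\<^sup>2 / 6 * (1 + lam\<^sup>2) powr (3/2)" for lam :: real
proof -
  have "1 + lam\<^sup>2 \<noteq> 0" by (smt (verit) zero_le_power2)
  then show ?thesis by (intro mult_pos_pos) auto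
qed

lemma limsup_scaled_radius:
  assumes "0 < lam" "lam < 1" "lam \<notin> \<rat>"
  defines "C \<equiv> pi\<^sup>2 / 6 * (1 + lam\<^sup>2) powr (3/2)"
  shows "ereal C \<le> limsup (\<lambda>Q. ereal (scaled_radius Q lam))"
    and "limsup (\<lambda>Q. ereal (scaled_radius Q lam)) \<le> ereal (2 * C)"
proof -
  obtain lo hi where lim: "lo \<longlonglongrightarrow> C" "hi \<longlonglongrightarrow> C"
    and bounds: "\<forall>\<^sub>F Q in sequentially. \<forall>q a r b. farey_pair lam Q q a r b \<longrightarrow>
       lo Q * farey_ratio Q q r \<le> scaled_radius Q lam \<and> scaled_radius Q lam \<le> hi Q * farey_ratio Q q r"
    by (rule scaled_radius_bounds[OF assms(1,2), folded C_def])
  have "C > 0" unfolding C_def by (rule limit_const_pos)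
  have pos: "\<forall>\<^sub>F Q in sequentially. lo Q > 0" "\<forall>\<^sub>F Q in sequentially. hi Q > 0"
    using order_tendstoD(1)[OF lim(1) \<open>C > 0\<close>] order_tendstoD(1)[OF lim(2) \<open>C > 0\<close>] by auto
  have "\<forall>\<^sub>F Q in sequentially. scaled_radius Q lam \<le> 2 * hi Q"
    using bounds pos(2) eventually_ge_at_top[of 1]
  proof eventually_elim
    case (elim Q)
    obtain q a r b where f: "farey_pair lam Q q a r b" using farey_pair_exists[OF assms(1-3) elim(3)] by blast
    then have "scaled_radius Q lam \<le> hi Q * farey_ratio Q q r" using elim by blast
    also have "\<dots> \<le> hi Q * 2" using farey_ratio_le(2)[OF f] elim by (intro mult_left_mono) auto
    finally show ?case by simp
  qed
  then have "limsup (\<lambda>Q. ereal (scaled_radius Q lam)) \<le> limsup (\<lambda>Q. ereal (2 * hi Q))"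
    by (intro Limsup_mono) auto
  also have "\<dots> = ereal (2 * C)"
    using lim(2) by (intro lim_imp_Limsup) (auto intro!: tendsto_intros)
  finally show "limsup (\<lambda>Q. ereal (scaled_radius Q lam)) \<le> ereal (2 * C)" .
  show "ereal C \<le> limsup (\<lambda>Q. ereal (scaled_radius Q lam))"
  proof (rule ccontr)
    assume "\<not> ?thesis"
    \<comment> \<open>With y strictly between, the radius is eventually below y <
      \<open>lo Q\<close>, which excludes ratios of at least 1, although these recur at arbitrarily
      large orders.\<close>
    then obtain y where y: "limsup (\<lambda>Q. ereal (scaled_radius Q lam)) < ereal y" "ereal y < ereal C"
      using ereal_dense2[of "limsup (\<lambda>Q. ereal (scaled_radius Q lam))" "ereal C"] by (auto simp: not_le)
    have "\<forall>\<^sub>F Q in sequentially. ereal (scaled_radius Q lam) < ereal y"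
      using Limsup_lessD[OF y(1)] .
    moreover have "\<forall>\<^sub>F Q in sequentially. y < lo Q"
      using y(2) by (intro order_tendstoD[OF lim(1)]) simp
    ultimately have "\<forall>\<^sub>F Q in sequentially. \<not> (\<exists>q a r b. farey_pair lam Q q a r b \<and> farey_ratio Q q r \<ge> 1)"
      using bounds pos(1)
    proof eventually_elim
      case (elim Q)
      show ?case
      proof clarify
        fix q a r b assume f: "farey_pair lam Q q a r b" "farey_ratio Q q r \<ge> 1"
        have "lo Q * 1 \<le> lo Q * farey_ratio Q q r" using f(2) elim(4) by (intro mult_left_mono) auto
        also have "\<dots> \<le> scaled_radius Q lam" using f(1) elim(3) by blast
        finally show False using elim(1,2) by simp
      qed
    qed
    then show False using frequently_farey_ratio_ge_1[OF assms(1-3)] by (simp add: frequently_def)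
  qed
qed

text \<open>A positive lower limit and a bound min q r >= \<open>\<delta>\<close> Q for large Q are
  equivalent, through the two estimates of the ratio by the smaller denominator; the continued
  fraction lemmas then connect the latter with bounded quotients.\<close>

lemma liminf_scaled_radius:
  assumes "0 < lam" "lam < 1" "lam \<notin> \<rat>"
  shows "liminf (\<lambda>Q. ereal (scaled_radius Q lam)) > 0 \<longleftrightarrow> badly_approximable lam"
    and "0 \<le> liminf (\<lambda>Q. ereal (scaled_radius Q lam))"
proof -
  interpret irrational_unit lam using assms by unfold_locales
  define C where "C = pi\<^sup>2 / 6 * (1 + lam\<^sup>2) powr (3/2)"
  obtain lo hi where lim: "lo \<longlonglongrightarrow> C" "hi \<longlonglongrightarrow> C"
    and bounds: "\<forall>\<^sub>F Q in sequentially. \<forall>q a r b. farey_pair lam Q q a r b \<longrightarrow>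
       lo Q * farey_ratio Q q r \<le> scaled_radius Q lam \<and> scaled_radius Q lam \<le> hi Q * farey_ratio Q q r"
    by (rule scaled_radius_bounds[OF assms(1,2), folded C_def])
  have "C > 0" unfolding C_def by (rule limit_const_pos)
  have lo: "\<forall>\<^sub>F Q in sequentially. lo Q > C / 2" and hi: "\<forall>\<^sub>F Q in sequentially. 0 < hi Q \<and> hi Q < 2 * C"
    using order_tendstoD(1)[OF lim(1), of "C/2"] order_tendstoD[OF lim(2)] \<open>C > 0\<close> by (auto intro: eventually_conj)
  have lower: "ereal (C / 2 * (\<delta> / 2)) \<le> liminf (\<lambda>Q. ereal (scaled_radius Q lam))"
    if "0 \<le> \<delta>" and bal: "\<And>Q q a r b. farey_pair lam Q q a r b \<Longrightarrow> \<delta> * real Q \<le> of_int (min q r)" for \<delta>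
  proof (rule Liminf_bounded)
    show "\<forall>\<^sub>F Q in sequentially. ereal (C / 2 * (\<delta> / 2)) \<le> ereal (scaled_radius Q lam)"
      using bounds lo eventually_ge_at_top[of 1]
    proof eventually_elim
      case (elim Q)
      obtain q a r b where f: "farey_pair lam Q q a r b" using farey_pair_exists[OF assms elim(3)] by blast
      have "\<delta> / 2 \<le> farey_ratio Q q r"
        using bal[OF f] by (intro farey_ratio_ge[OF f _ _ \<open>0 \<le> \<delta>\<close>]) auto
      then have "C / 2 * (\<delta> / 2) \<le> lo Q * farey_ratio Q q r"
        using elim(2) \<open>0 \<le> \<delta>\<close> \<open>C > 0\<close> by (intro mult_mono) auto
      also have "\<dots> \<le> scaled_radius Q lam" using f elim(1) by blast
      finally show ?case by simp
    qed
  qed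
  \<comment> \<open>The trivial balance constant 0 already yields nonnegativity.\<close>
  have "ereal (C / 2 * (0 / 2)) \<le> liminf (\<lambda>Q. ereal (scaled_radius Q lam))"
    by (rule lower) (auto simp: farey_pair_def)
  then show "0 \<le> liminf (\<lambda>Q. ereal (scaled_radius Q lam))" by (simp add: zero_ereal_def)
  show "liminf (\<lambda>Q. ereal (scaled_radius Q lam)) > 0 \<longleftrightarrow> badly_approximable lam"
  proof
    assume "badly_approximable lam"
    then obtain B where B: "\<And>n. partial_quotient lam n \<le> B" by (auto simp: badly_approximable_def)
    obtain \<delta> where \<delta>: "0 < \<delta>" "\<And>Q q a r b. farey_pair lam Q q a r b \<Longrightarrow> \<delta> * real Q \<le> of_int (min q r)"
      using farey_pair_balanced[OF B] by blast
    have "ereal (C / 2 * (\<delta> / 2)) > 0" using \<delta> \<open>C > 0\<close> by simp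
    then show "liminf (\<lambda>Q. ereal (scaled_radius Q lam)) > 0"
      using lower[of \<delta>] \<delta> by (meson less_imp_le less_le_trans)
  next
    assume "liminf (\<lambda>Q. ereal (scaled_radius Q lam)) > 0"
    then obtain e where e: "0 < e" "ereal e < liminf (\<lambda>Q. ereal (scaled_radius Q lam))"
      using ereal_dense2[of 0] by auto
    have "\<forall>\<^sub>F Q in sequentially. \<forall>q a r b. farey_pair lam Q q a r b \<longrightarrow> e / (4 * C) * real Q \<le> of_int (min q r)"
      using less_LiminfD[OF e(2)] bounds hi eventually_ge_at_top[of 1]
    proof (eventually_elim, intro allI impI)
      fix Q q a r b
      assume *: "ereal e < ereal (scaled_radius Q lam)"
        "\<forall>q a r b. farey_pair lam Q q a r b \<longrightarrow>
          lo Q * farey_ratio Q q r \<le> scaled_radius Q lam \<and> scaled_radius Q lam \<le> hi Q * farey_ratio Q q r"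
        "0 < hi Q \<and> hi Q < 2 * C" "1 \<le> Q" and f: "farey_pair lam Q q a r b"
      \<comment> \<open>The factor 4 C combines \<open>hi Q\<close> < 2 C with the bound 2 min q r /
        Q for the ratio.\<close>
      have "e \<le> hi Q * farey_ratio Q q r" using * f by fastforce
      also have "\<dots> \<le> 2 * C * (2 * of_int (min q r) / real Q)"
        using * farey_ratio_le[OF f] by (intro mult_mono) auto
      finally show "e / (4 * C) * real Q \<le> of_int (min q r)"
        using \<open>C > 0\<close> *(4) by (simp add: field_simps)
    qed
    then obtain N where N: "\<And>Q q a r b. N \<le> Q \<Longrightarrow> farey_pair lam Q q a r b \<Longrightarrow> e / (4 * C) * real Q \<le> of_int (min q r)"
      unfolding eventually_sequentially by blast
    have "\<exists>B. \<forall>n. partial_quotient lam n \<le> B"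
      by (rule bounded_quotients_of_balanced[OF _ N]) (use e \<open>C > 0\<close> in auto)
    then show "badly_approximable lam" using assms by (simp add: badly_approximable_def)
  qed
qed

lemma AE_irrational_not_badly_approximable:
  "AE lam in lebesgue_on {0..1}. 0 < lam \<and> lam < 1 \<and> lam \<notin> \<rat> \<and> \<not> badly_approximable lam"
proof -
  have "(\<rat> :: real set) \<in> null_sets lebesgue"
    by (intro null_sets_completionI countable_imp_null_set_lborel countable_rat)
  then have "AE lam in lebesgue. lam \<notin> (\<rat> :: real set)" by (rule AE_not_in)
  moreover have "AE lam in lebesgue. lam \<notin> {x. badly_approximable x}"
    by (rule AE_not_in[OF badly_approximable_null])
  ultimately have "AE lam in lebesgue. lam \<in> {0..1} \<longrightarrow> 0 < lam \<and> lam < 1 \<and> lam \<notin> \<rat> \<and> \<not> badly_approximable lam"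
  proof eventually_elim
    case (elim lam)
    then have "lam \<noteq> 0" "lam \<noteq> 1" by auto
    with elim show ?case by auto
  qed
  then show ?thesis by (subst AE_restrict_space_iff) auto
qed

text \<open>At rational \<open>lam\<close> the radius is read as its two one-sided values, so the
  equivalence in (c) is stated for each of them; both sides are false there.\<close>

theorem theorem7:
  shows "(\<forall>lam::real. 0 \<le> lam \<and> lam \<le> 1 \<longrightarrow>
      (lam \<in> \<rat> \<longrightarrow>
         (\<lambda>Q. scaled_radius_right Q lam) \<longlonglongrightarrow> 0 \<and>
         (\<lambda>Q. scaled_radius_left Q lam) \<longlonglongrightarrow> 0) \<and>
      (lam \<notin> \<rat> \<longrightarrow>
         limsup (\<lambda>Q. ereal (scaled_radius Q lam))
           \<in> {ereal (pi^2 / 6 * (1 + lam^2) powr (3/2)) .. ereal (pi^2 / 3 * (1 + lam^2) powr (3/2))}) \<and>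
      (lam \<notin> \<rat> \<longrightarrow>
         (liminf (\<lambda>Q. ereal (scaled_radius Q lam)) > 0 \<longleftrightarrow> badly_approximable lam)) \<and>
      (lam \<in> \<rat> \<longrightarrow>
         (liminf (\<lambda>Q. ereal (scaled_radius_right Q lam)) > 0 \<longleftrightarrow> badly_approximable lam) \<and>
         (liminf (\<lambda>Q. ereal (scaled_radius_left Q lam)) > 0 \<longleftrightarrow> badly_approximable lam))) \<and>
    (AE lam in lebesgue_on {0..1}.
        limsup (\<lambda>Q. ereal (scaled_radius Q lam)) > 0 \<and>
        liminf (\<lambda>Q. ereal (scaled_radius Q lam)) = 0)"
proof (intro conjI allI impI)
  fix lam :: real assume lam: "0 \<le> lam \<and> lam \<le> 1"
  { assume rat: "lam \<in> \<rat>"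
    have lim: "(\<lambda>Q. scaled_radius_right Q lam) \<longlonglongrightarrow> 0" "(\<lambda>Q. scaled_radius_left Q lam) \<longlonglongrightarrow> 0"
      using scaled_radius_rational[OF rat] lam by auto
    then show "(\<lambda>Q. scaled_radius_right Q lam) \<longlonglongrightarrow> 0" "(\<lambda>Q. scaled_radius_left Q lam) \<longlonglongrightarrow> 0" .
    have "\<not> badly_approximable lam" using rat by (simp add: badly_approximable_def)
    moreover have "liminf (\<lambda>Q. ereal (scaled_radius_right Q lam)) = ereal 0"
      using lim(1) by (intro lim_imp_Liminf) auto
    moreover have "liminf (\<lambda>Q. ereal (scaled_radius_left Q lam)) = ereal 0"
      using lim(2) by (intro lim_imp_Liminf) auto
    ultimately show "liminf (\<lambda>Q. ereal (scaled_radius_right Q lam)) > 0 \<longleftrightarrow> badly_approximable lam"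
      "liminf (\<lambda>Q. ereal (scaled_radius_left Q lam)) > 0 \<longleftrightarrow> badly_approximable lam"
      by simp_all }
  { assume irr: "lam \<notin> \<rat>"
    then have "lam \<noteq> 0" "lam \<noteq> 1" by auto
    then have *: "0 < lam" "lam < 1" using lam by auto
    show "limsup (\<lambda>Q. ereal (scaled_radius Q lam))
        \<in> {ereal (pi^2 / 6 * (1 + lam^2) powr (3/2)) .. ereal (pi^2 / 3 * (1 + lam^2) powr (3/2))}"
      using limsup_scaled_radius[OF * irr] by simp
    show "liminf (\<lambda>Q. ereal (scaled_radius Q lam)) > 0 \<longleftrightarrow> badly_approximable lam"
      by (rule liminf_scaled_radius(1)[OF * irr]) }
next
  show "AE lam in lebesgue_on {0..1}. limsup (\<lambda>Q. ereal (scaled_radius Q lam)) > 0 \<and>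
      liminf (\<lambda>Q. ereal (scaled_radius Q lam)) = 0"
    using AE_irrational_not_badly_approximable
  proof eventually_elim
    case (elim lam)
    then have *: "0 < lam" "lam < 1" "lam \<notin> \<rat>" by auto
    have "0 < ereal (pi\<^sup>2 / 6 * (1 + lam\<^sup>2) powr (3/2))" using limit_const_pos[of lam] by simp
    then have "limsup (\<lambda>Q. ereal (scaled_radius Q lam)) > 0"
      using limsup_scaled_radius(1)[OF *] by (rule less_le_trans)
    moreover have "liminf (\<lambda>Q. ereal (scaled_radius Q lam)) = 0"
      using liminf_scaled_radius[OF *] elim by (auto simp: order_antisym not_less)
    ultimately show ?case ..
  qed
qed

end
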